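(* Let $\mathcal{A}$ be a nonnegative combinatorially symmetric weakly irreducible tensor of order $m$ and dimension $n\ge 2$. Suppose that there are invertible matrices $P,Q$ over $\mathbb{Z}_m$ such that $PB_{\mathcal{A}}Q$ is the Smith normal form of $B_{\mathcal{A}}$ over $\mathbb{Z}_m$, i.e. its only nonzero entries are the diagonal entries $d_1,\dots,d_r$ in positions $(1,1),\dots,(r,r)$, where $r\ge0$, $1\le d_i\le m-1$, $d_i\mid d_{i+1}$ and $d_i\mid m$. Then $1\le r\le n-1$ and $$\mathbb{P}\mathbb{S}_0(\mathcal{A})\cong\bigoplus_{i:\,d_i\ne1}\mathbb{Z}_{d_i}\oplus\underbrace{\mathbb{Z}_m\oplus\cdots\oplus\mathbb{Z}_m}_{n-1-r\text{ copies}}$$ as $\mathbb{Z}_m$-modules. Consequently $s(\mathcal{A})=m^{n-1-r}\prod_{i=1}^r d_i$ and $\gamma(\mathcal{A})=\sum_{i:\,d_i\ne1}\mathrm{cl}(d_i)+(n-1-r)\mathrm{cl}(m)$, and $s(\mathcal{A})\mid m^{n-1}$, $s(\mathcal{A})<m^{n-1}$, $\gamma(\mathcal{A})<(n-1)\mathrm{cl}(m)$.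
   Context: Tensors: order $m$, dimension $n$, entries $a_{i_1\cdots i_m}$. Eigenvectors: $\mathcal{A}x^{m-1}=\lambda x^{[m-1]}$, $x\neq0$, with $(\mathcal{A}x^{m-1})_i=\sum a_{ii_2\cdots i_m}x_{i_2}\cdots x_{i_m}$, $x^{[m-1]}=(x_i^{m-1})$; $\rho(\mathcal{A})$ the spectral radius (largest modulus of an eigenvalue). Weakly irreducible: the digraph on $[n]$ with arc $(i,j)$ whenever some $a_{ii_2\cdots i_m}\neq0$ with $j\in\{i_2,\dots,i_m\}$ is strongly connected. Combinatorially symmetric: support invariant under index permutations. Incidence matrix $B_{\mathcal{A}}$: rows indexed by $E(\mathcal{A})=\{(i_1,\dots,i_m): a_{i_1\cdots i_m}\ne0,\ i_1\le\dots\le i_m\}$, $b_{e,j}=|\{k:i_k=j\}|$, viewed over $\mathbb{Z}_m$. $\mathbb{P}\mathbb{S}_0(\mathcal{A})=\{x\in\mathbb{Z}_m^n: B_{\mathcal{A}}x=0,\ x_1=0\}$. For diagonal $D$, $(D^{-(m-1)}\mathcal{A}D)_{i_1\cdots i_m}=d_{i_1}^{-(m-1)}a_{i_1\cdots i_m}d_{i_2}\cdots d_{i_m}$. Stabilizing index: $s(\mathcal{A})=|\{D \text{ invertible diagonal}: d_{11}=1,\ \mathcal{A}=D^{-(m-1)}\mathcal{A}D\}|$. Stabilizing dimension $\gamma(\mathcal{A})$: let $\mathbb{P}\mathbb{V}_{\rho(\mathcal{A})}$ be the set of eigenvectors for $\rho(\mathcal{A})$ normalized with $y_1=1$ (these have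 no zero entries), $v_p$ its positive element, $D_y=\mathrm{diag}(y_i/|y_i|)$, $y\circ\hat y=D_yD_{\hat y}v_p$; this makes $\mathbb{P}\mathbb{V}_{\rho(\mathcal{A})}$ an abelian group of exponent dividing $m$, i.e. a $\mathbb{Z}_m$-module, and $\gamma(\mathcal{A})$ is its composition length. For $d\mid m$, $\mathrm{cl}(d)$ is the composition length of $\mathbb{Z}_d$, i.e. the number of prime factors of $d$ counted with multiplicity. *)

theory Defs
  imports Complex_Main "HOL-Library.List_Lexorder" "HOL-Algebra.Group"
    "HOL-Computational_Algebra.Primes" "Jordan_Normal_Form.Matrix"
begin

text \<open>Conventions. Indices are 0-based: the index set [n] is {0..<n}, so the paper's
  coordinate 1 is coordinate 0 here. A tensor of order m and dimension n is a function
  A :: nat list \<Rightarrow> real; only its values on index lists of length m with entries < n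
  (valid index lists) are ever used. Vectors of length n are functions on nat that vanish
  outside {0..<n}.\<close>

definition idx :: "nat \<Rightarrow> nat \<Rightarrow> nat list set" where
  "idx k n = {is. length is = k \<and> set is \<subseteq> {..<n}}"

definition nonneg_tensor :: "(nat list \<Rightarrow> real) \<Rightarrow> nat \<Rightarrow> nat \<Rightarrow> bool" where
  "nonneg_tensor A m n \<longleftrightarrow> (\<forall>is \<in> idx m n. A is \<ge> 0)"

definition comb_symmetric :: "(nat list \<Rightarrow> real) \<Rightarrow> nat \<Rightarrow> nat \<Rightarrow> bool" where
  "comb_symmetric A m n \<longleftrightarrow>
     (\<forall>is \<in> idx m n. \<forall>js. mset js = mset is \<longrightarrow> (A is \<noteq> 0 \<longleftrightarrow> A js \<noteq> 0))"

text \<open>Arcs of the digraph associated with A: (i,j) whenever some a_{i i2...im} is nonzero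
  with j among i2,...,im.\<close>
definition tensor_arcs :: "(nat list \<Rightarrow> real) \<Rightarrow> nat \<Rightarrow> nat \<Rightarrow> (nat \<times> nat) set" where
  "tensor_arcs A m n = {(i, j). \<exists>is. i < n \<and> is \<in> idx (m - 1) n \<and> A (i # is) \<noteq> 0 \<and> j \<in> set is}"

definition weakly_irreducible :: "(nat list \<Rightarrow> real) \<Rightarrow> nat \<Rightarrow> nat \<Rightarrow> bool" where
  "weakly_irreducible A m n \<longleftrightarrow>
     (\<forall>i < n. \<forall>j < n. (i, j) \<in> (tensor_arcs A m n)\<^sup>*)"

text \<open>(A x^{m-1})_i\<close>
definition tensor_apply :: "(nat list \<Rightarrow> real) \<Rightarrow> nat \<Rightarrow> nat \<Rightarrow> (nat \<Rightarrow> complex) \<Rightarrow> nat \<Rightarrow> complex" where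
  "tensor_apply A m n x i = (\<Sum>is \<in> idx (m - 1) n. complex_of_real (A (i # is)) * prod_list (map x is))"

definition cvecs :: "nat \<Rightarrow> (nat \<Rightarrow> complex) set" where
  "cvecs n = {x. \<forall>i \<ge> n. x i = 0}"

definition is_eigenpair :: "(nat list \<Rightarrow> real) \<Rightarrow> nat \<Rightarrow> nat \<Rightarrow> complex \<Rightarrow> (nat \<Rightarrow> complex) \<Rightarrow> bool" where
  "is_eigenpair A m n lam x \<longleftrightarrow> x \<in> cvecs n \<and> (\<exists>i < n. x i \<noteq> 0) \<and>
     (\<forall>i < n. tensor_apply A m n x i = lam * x i ^ (m - 1))"

definition tensor_spectral_radius :: "(nat list \<Rightarrow> real) \<Rightarrow> nat \<Rightarrow> nat \<Rightarrow> real" where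
  "tensor_spectral_radius A m n = Sup (cmod ` {lam. \<exists>x. is_eigenpair A m n lam x})"

text \<open>PV_rho: eigenvectors for rho(A) normalised by y_1 = 1 (here y 0 = 1).\<close>
definition PV_rho :: "(nat list \<Rightarrow> real) \<Rightarrow> nat \<Rightarrow> nat \<Rightarrow> (nat \<Rightarrow> complex) set" where
  "PV_rho A m n = {y. is_eigenpair A m n (complex_of_real (tensor_spectral_radius A m n)) y \<and> y 0 = 1}"

definition PV_pos :: "(nat list \<Rightarrow> real) \<Rightarrow> nat \<Rightarrow> nat \<Rightarrow> nat \<Rightarrow> complex" where
  "PV_pos A m n = (THE v. v \<in> PV_rho A m n \<and> (\<forall>i < n. v i \<in> \<real> \<and> Re (v i) > 0))"

text \<open>y o yhat = D_y D_yhat v_p with D_y = diag(y_i/|y_i|).\<close>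
definition PV_mult :: "(nat list \<Rightarrow> real) \<Rightarrow> nat \<Rightarrow> nat \<Rightarrow> (nat \<Rightarrow> complex) \<Rightarrow> (nat \<Rightarrow> complex) \<Rightarrow> nat \<Rightarrow> complex" where
  "PV_mult A m n y z = (\<lambda>i. if i < n then (y i / complex_of_real (cmod (y i))) *
      (z i / complex_of_real (cmod (z i))) * PV_pos A m n i else 0)"

definition PV_group :: "(nat list \<Rightarrow> real) \<Rightarrow> nat \<Rightarrow> nat \<Rightarrow> (nat \<Rightarrow> complex) monoid" where
  "PV_group A m n = \<lparr>carrier = PV_rho A m n, mult = PV_mult A m n, one = PV_pos A m n\<rparr>"

text \<open>Composition length of a (finite) group: the maximal length of a strictly increasing
  chain of subgroups from the trivial subgroup to the whole group. For abelian groups of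
  exponent dividing m the subgroups are exactly the Z_m-submodules, so this is the
  composition length as a Z_m-module.\<close>
definition composition_length :: "('a, 'b) monoid_scheme \<Rightarrow> nat" where
  "composition_length G = Max {length Hs - 1 | Hs. Hs \<noteq> [] \<and> hd Hs = {\<one>\<^bsub>G\<^esub>} \<and> last Hs = carrier G \<and>
      (\<forall>i < length Hs. subgroup (Hs ! i) G) \<and> (\<forall>i. Suc i < length Hs \<longrightarrow> Hs ! i \<subset> Hs ! Suc i)}"

definition stabilizing_dimension :: "(nat list \<Rightarrow> real) \<Rightarrow> nat \<Rightarrow> nat \<Rightarrow> nat" where
  "stabilizing_dimension A m n = composition_length (PV_group A m n)"

text \<open>Stabilizing index: number of invertible diagonal D (diagonal entries d 0..d (n-1),
  complex) with d_11 = 1 and A = D^{-(m-1)} A D.\<close>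
definition stabilizing_index :: "(nat list \<Rightarrow> real) \<Rightarrow> nat \<Rightarrow> nat \<Rightarrow> nat" where
  "stabilizing_index A m n = card {d :: nat \<Rightarrow> complex. d 0 = 1 \<and> (\<forall>i < n. d i \<noteq> 0) \<and> (\<forall>i \<ge> n. d i = 0) \<and>
      (\<forall>is \<in> idx m n. complex_of_real (A is) =
          inverse (d (hd is)) ^ (m - 1) * complex_of_real (A is) * prod_list (map d (tl is)))}"

text \<open>cl(d): number of prime factors of d counted with multiplicity.\<close>
definition cl :: "nat \<Rightarrow> nat" where
  "cl d = size (prime_factorization d)"

text \<open>E(A) and the incidence matrix B_A (integer entries, read over Z_m);
  rows are E(A) listed in lexicographic order.\<close>
definition tensor_E :: "(nat list \<Rightarrow> real) \<Rightarrow> nat \<Rightarrow> nat \<Rightarrow> nat list set" where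
  "tensor_E A m n = {is \<in> idx m n. sorted is \<and> A is \<noteq> 0}"

definition incidence_mat :: "(nat list \<Rightarrow> real) \<Rightarrow> nat \<Rightarrow> nat \<Rightarrow> int mat" where
  "incidence_mat A m n = (let es = sorted_list_of_set (tensor_E A m n) in
     mat (length es) n (\<lambda>(k, j). int (count (mset (es ! k)) j)))"

definition mod_mat :: "int \<Rightarrow> int mat \<Rightarrow> int mat" where
  "mod_mat m M = map_mat (\<lambda>a. a mod m) M"

definition invertible_mod :: "int \<Rightarrow> nat \<Rightarrow> int mat \<Rightarrow> bool" where
  "invertible_mod m k P \<longleftrightarrow> P \<in> carrier_mat k k \<and>
     (\<exists>P' \<in> carrier_mat k k. mod_mat m (P * P') = mod_mat m (1\<^sub>m k) \<and> mod_mat m (P' * P) = mod_mat m (1\<^sub>m k))"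

text \<open>Direct sums Z_{ms!0} + ... + Z_{ms!(l-1)}, elements represented by their canonical
  residues, as Z_m-modules.\<close>
definition zsum_carrier :: "int list \<Rightarrow> (nat \<Rightarrow> int) set" where
  "zsum_carrier ms = {y. (\<forall>k < length ms. 0 \<le> y k \<and> y k < ms ! k) \<and> (\<forall>k \<ge> length ms. y k = 0)}"

definition zsum_add :: "int list \<Rightarrow> (nat \<Rightarrow> int) \<Rightarrow> (nat \<Rightarrow> int) \<Rightarrow> nat \<Rightarrow> int" where
  "zsum_add ms y z = (\<lambda>k. if k < length ms then (y k + z k) mod (ms ! k) else 0)"

definition zsum_smult :: "int list \<Rightarrow> int \<Rightarrow> (nat \<Rightarrow> int) \<Rightarrow> nat \<Rightarrow> int" where
  "zsum_smult ms c y = (\<lambda>k. if k < length ms then (c * y k) mod (ms ! k) else 0)"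

text \<open>PS_0(A) = {x in Z_m^n : B_A x = 0, x_1 = 0}, a submodule of Z_m^n.\<close>
definition PS0 :: "(nat list \<Rightarrow> real) \<Rightarrow> nat \<Rightarrow> nat \<Rightarrow> (nat \<Rightarrow> int) set" where
  "PS0 A m n = {x \<in> zsum_carrier (replicate n (int m)). x 0 = 0 \<and>
     (\<forall>k < dim_row (incidence_mat A m n).
        (\<Sum>j < n. incidence_mat A m n $$ (k, j) * x j) mod int m = 0)}"

text \<open>Z_m-module isomorphism between a submodule S of the direct sum with moduli ms1 and a
  submodule T of the direct sum with moduli ms2 (scalars c taken as integers, acting
  through their residue mod m).\<close>
definition zmod_iso :: "int list \<Rightarrow> (nat \<Rightarrow> int) set \<Rightarrow> int list \<Rightarrow> (nat \<Rightarrow> int) set \<Rightarrow> bool" where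
  "zmod_iso ms1 S ms2 T \<longleftrightarrow> (\<exists>\<phi>. bij_betw \<phi> S T \<and>
     (\<forall>x \<in> S. \<forall>y \<in> S. \<phi> (zsum_add ms1 x y) = zsum_add ms2 (\<phi> x) (\<phi> y)) \<and>
     (\<forall>c. \<forall>x \<in> S. \<phi> (zsum_smult ms1 c x) = zsum_smult ms2 c (\<phi> x)))"

end

(*
The all-ones vector lies in the kernel of the incidence matrix over Z_m. In Smith coordinates the
kernel is the sum of the annihilators of d_1, ..., d_r and of n - r copies of Z_m; the all-ones
vector has order m, which forces r < n. Since Z_m has stable range 1, an elementary
change of the last (free) coordinate makes the last coordinate of the all-ones vector a unit, so
splitting off this vector removes one copy of Z_m and leaves PS_0.

Diagonal matrices in the stabilizer have m-th roots of unity as entries, since d_i^m is constant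
along arcs; their exponents form PS_0. By Perron-Frobenius theory every eigenvector for the
spectral radius is a stabilizer element times the Perron vector. The composition length of a finite
abelian group is the number of prime factors of its order, so the stabilizing dimension is read off
from the stabilizing index alone.
*)
theory Submission
  imports "HOL-Analysis.Function_Topology" "HOL-Algebra.Multiplicative_Group"
    "HOL-Number_Theory.Cong" Defs
begin

section \<open>Composition length of finite abelian groups\<close>

text \<open>Subtracting x_0 times the all-ones vector splits the kernel as the line through that
  vector plus PS_0, so Z_m + PS_0 is isomorphic to the sum of the Smith summands, and the task is to
  cancel Z_m. An explicit projection does this. The obstacle is that the all-ones vector sits
  obliquely in Smith coordinates: its coordinates may all be non-units modulo m. One relation is
  always available: row 0 of Q, applied to these coordinates, returns the entry 1, so they generate
  the unit ideal. From this comes a linear functional \<open>cut\<close> with a unit value at the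
  all-ones vector. Inside the kernel, PS_0 and \<open>cut = 0\<close> are then two complements of
  the same line, so projection along the line carries one to the other, and \<open>cut = 0\<close>
  is parametrized freely by the first n - 1 coordinates. The eigenvalue problem is nonlinear, so the
  Perron vector is found variationally: least t with F x \<le> t x^[m-1] for some positive x, where
  weak irreducibility supplies both compactness and equality at the optimum.\<close>

lemma cl_mult: "a \<noteq> 0 \<Longrightarrow> b \<noteq> 0 \<Longrightarrow> cl (a * b) = cl a + cl b"
  by (simp add: cl_def prime_factorization_mult)

lemma cl_1 [simp]: "cl (Suc 0) = 0"
  by (simp add: cl_def)

lemma cl_prime: "prime p \<Longrightarrow> cl p = 1"
  by (simp add: cl_def prime_factorization_prime)

lemma cl_pos: "1 < a \<Longrightarrow> 0 < cl a"
  by (auto simp: cl_def prime_factorization_empty_iff nonempty_has_size[symmetric])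

lemma cl_strict_mono_dvd:
  assumes "a dvd b" "a < b"
  shows "cl a < cl b"
proof -
  obtain c where c: "b = a * c" using assms by auto
  then have "a \<noteq> 0" "1 < c" using assms by (auto intro!: Suc_lessI gr0I)
  then show ?thesis using cl_pos[of c] by (simp add: c cl_mult)
qed

lemma cl_prod:
  "finite I \<Longrightarrow> (\<And>i. i \<in> I \<Longrightarrow> f i \<noteq> 0) \<Longrightarrow> cl (\<Prod>i\<in>I. f i) = (\<Sum>i\<in>I. cl (f i))"
  by (induction I rule: finite_induct) (auto simp: cl_mult)

lemma cl_power: "a \<noteq> 0 \<Longrightarrow> cl (a ^ k) = k * cl a"
  by (induction k) (auto simp: cl_mult)

lemma (in group) card_subgroup_dvd_card_subgroup:
  assumes "finite (carrier G)" "subgroup H G" "subgroup K G" "H \<subseteq> K"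
  shows "card H dvd card K"
proof -
  interpret K: group "G\<lparr>carrier := K\<rparr>" using assms(3) by (rule subgroup_imp_group)
  have "subgroup H (G\<lparr>carrier := K\<rparr>)" by (rule subgroup_incl[OF assms(2-4)])
  moreover have "finite K" using assms(1) subgroup.subset[OF assms(3)] finite_subset by blast
  ultimately have "card (rcosets\<^bsub>G\<lparr>carrier := K\<rparr>\<^esub> H) * card H = card K"
    using K.lagrange_finite[of H] by (simp add: order_def)
  then show ?thesis by (metis dvd_triv_right)
qed

text \<open>An element y outside H has an order k > 1 modulo H. For a prime p dividing k, the power
  y^(k/p) has order exactly p modulo H, so adjoining it multiplies the cardinality by p.\<close>

lemma (in comm_group) prime_index_extension:
  assumes fin: "finite (carrier G)" and H: "subgroup H G" and ne: "H \<noteq> carrier G"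
  obtains K p where "subgroup K G" "H \<subset> K" "prime p" "card K = p * card H"
proof -
  interpret H: subgroup H G by (rule H)
  obtain y where y: "y \<in> carrier G" "y \<notin> H" using ne H.subset by blast
  define k where "k = (LEAST k. 0 < k \<and> y [^] (k::nat) \<in> H)"
  have ex: "0 < order G \<and> y [^] order G \<in> H"
    using y fin by (simp add: pow_order_eq_1 order_gt_0_iff_finite)
  have k: "0 < k" "y [^] k \<in> H" "\<And>l. 0 < l \<Longrightarrow> y [^] l \<in> H \<Longrightarrow> k \<le> l"
    using LeastI[of "\<lambda>k. 0 < k \<and> y [^] (k::nat) \<in> H", OF ex]
      Least_le[of "\<lambda>k. 0 < k \<and> y [^] (k::nat) \<in> H"] by (auto simp: k_def)
  have "k \<noteq> 1" using k y by auto
  then obtain p where p: "prime p" "p dvd k" using prime_factor_nat by blast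
  define x where "x = y [^] (k div p)"
  have x: "x \<in> carrier G" using y by (simp add: x_def)
  have p1: "1 < p" using p prime_gt_1_nat by auto
  have "0 < k div p" "k div p < k"
    using p p1 k by (auto simp: dvd_div_eq_0_iff intro!: Nat.gr0I div_less_dividend)
  then have xH: "x \<notin> H" using k(3)[of "k div p"] by (auto simp: x_def)
  have xp: "x [^] p \<in> H" using k p y by (simp add: x_def nat_pow_pow)
  have pow_pow: "(x [^] l) [^] w = x [^] (w * int l)" for l and w :: int
    using x by (metis int_pow_int int_pow_pow mult.commute)
  have x_pow_notin: "x [^] j \<notin> H" if j: "0 < j" "j < p" for j :: nat
  proof
    assume jH: "x [^] j \<in> H"
    \<comment> \<open>Bezout: with j and p coprime, x^j and x^p in H would put x itself into
      H.\<close>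
    have "coprime (int j) (int p)"
      using p j by (metis coprime_commute coprime_int_iff nat_dvd_not_less prime_imp_coprime)
    then obtain u v where "u * int j + v * int p = 1"
      by (metis bezout_int coprime_imp_gcd_eq_1)
    moreover have "x [^] (u * int j + v * int p) = (x [^] j) [^] u \<otimes> (x [^] p) [^] v"
      using x by (simp add: int_pow_mult pow_pow)
    moreover have "\<dots> \<in> H"
      using jH xp H by (intro H.m_closed subgroup_int_pow_closed) auto
    ultimately show False using xH x by simp
  qed
  define K where "K = H <#> generate G {x}"
  have K: "subgroup K G" unfolding K_def
    using x by (intro mult_subgroups H generate_is_subgroup) auto
  \<comment> \<open>Dividing the exponent by p with remainder moves the multiple of p into H.
    Injectivity of this parametrization, shown below, then gives the cardinality.\<close>
  have Keq: "K = (\<lambda>(h, j). h \<otimes> x [^] j) ` (H \<times> {..<p})"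
  proof (intro equalityI subsetI)
    fix z assume "z \<in> K"
    then obtain h i where hi: "h \<in> H" "z = h \<otimes> x [^] (i::int)"
      using x by (auto simp: K_def set_mult_def generate_pow)
    have "x [^] i = x [^] (i div int p * int p + i mod int p)" by simp
    also have "\<dots> = (x [^] p) [^] (i div int p) \<otimes> x [^] (i mod int p)"
      unfolding pow_pow using x by (rule int_pow_mult)
    also have "x [^] (i mod int p) = x [^] nat (i mod int p)"
      using p1 by (simp add: int_pow_int[symmetric])
    finally have "z = (h \<otimes> (x [^] p) [^] (i div int p)) \<otimes> x [^] nat (i mod int p)"
      using hi x by (simp add: m_assoc)
    moreover have "h \<otimes> (x [^] p) [^] (i div int p) \<in> H"
      using hi xp H by (intro H.m_closed subgroup_int_pow_closed) auto
    moreover have "nat (i mod int p) < p" using p1 by (simp add: nat_less_iff)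
    ultimately show "z \<in> (\<lambda>(h, j). h \<otimes> x [^] j) ` (H \<times> {..<p})" by force
  next
    fix z assume "z \<in> (\<lambda>(h, j). h \<otimes> x [^] j) ` (H \<times> {..<p})"
    then obtain h j where "h \<in> H" "z = h \<otimes> x [^] (j::nat)" by auto
    then show "z \<in> K" using x
      by (auto simp: K_def set_mult_def generate_pow int_pow_int[symmetric])
  qed
  have le: False if "h \<in> H" "h' \<in> H" "h \<otimes> x [^] i = h' \<otimes> x [^] j" "i < j" "j < p"
    for h h' and i j :: nat
  proof -
    have "h' \<otimes> x [^] j = (h' \<otimes> x [^] (j - i)) \<otimes> x [^] i"
      using that x by (simp add: m_assoc nat_pow_mult)
    then have "h = h' \<otimes> x [^] (j - i)"
      using that x by (metis H.mem_carrier m_closed nat_pow_closed right_cancel)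
    then have "x [^] (j - i) = inv h' \<otimes> h" using that x by (simp add: inv_solve_left)
    then have "x [^] (j - i) \<in> H" using that by simp
    then show False using x_pow_notin[of "j - i"] that by simp
  qed
  have inj: "inj_on (\<lambda>(h, j). h \<otimes> x [^] j) (H \<times> {..<p})"
  proof (rule inj_onI, clarify)
    fix h i h' j assume *: "h \<in> H" "h' \<in> H" "i < p" "j < p" "h \<otimes> x [^] (i::nat) = h' \<otimes> x [^] (j::nat)"
    have "i = j" using le[of h h' i j] le[of h' h j i] * by (metis linorder_neqE_nat)
    then show "h = h' \<and> i = j" using * x by (metis H.mem_carrier nat_pow_closed right_cancel)
  qed
  have "card K = p * card H"
    unfolding Keq card_image[OF inj] by (simp add: card_cartesian_product)
  moreover have "H \<subset> K"
  proof
    show "H \<subseteq> K"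
    proof
      fix h assume "h \<in> H"
      then show "h \<in> K" unfolding Keq using p1 by (intro image_eqI[of _ _ "(h, 0)"]) auto
    qed
    have "x \<in> K" unfolding Keq using p1 x by (intro image_eqI[of _ _ "(\<one>, 1)"]) auto
    then show "H \<noteq> K" using xH by auto
  qed
  ultimately show thesis using that K p by auto
qed

text \<open>By Lagrange, each strict inclusion replaces the cardinality by a proper multiple, which
  has at least one more prime factor. This bounds every chain from above.\<close>

lemma (in group) cl_card_subgroup_chain:
  assumes fin: "finite (carrier G)"
    and sub: "\<And>i. i < length Hs \<Longrightarrow> subgroup (Hs ! i) G"
    and chain: "\<And>i. Suc i < length Hs \<Longrightarrow> Hs ! i \<subset> Hs ! Suc i"
  shows "i < length Hs \<Longrightarrow> i \<le> cl (card (Hs ! i))"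
proof (induction i)
  case (Suc i)
  have "finite (Hs ! Suc i)" using sub[OF Suc.prems] fin subgroup.subset finite_subset by blast
  then have "card (Hs ! i) < card (Hs ! Suc i)" using chain[OF Suc.prems] psubset_card_mono by blast
  moreover have "card (Hs ! i) dvd card (Hs ! Suc i)"
    using Suc.prems sub chain fin by (intro card_subgroup_dvd_card_subgroup) auto
  ultimately have "cl (card (Hs ! i)) < cl (card (Hs ! Suc i))" by (rule cl_strict_mono_dvd[rotated])
  then show ?case using Suc by simp
qed simp

text \<open>Climbing from H by steps of prime index gains exactly one prime factor per step.
  Starting at an arbitrary H makes the induction on the remaining cardinality go through.\<close>

lemma (in comm_group) subgroup_chain_exists:
  assumes fin: "finite (carrier G)" and H: "subgroup H G"
  shows "\<exists>Hs. Hs \<noteq> [] \<and> hd Hs = H \<and> last Hs = carrier G \<and>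
    (\<forall>i < length Hs. subgroup (Hs ! i) G) \<and> (\<forall>i. Suc i < length Hs \<longrightarrow> Hs ! i \<subset> Hs ! Suc i) \<and>
    length Hs - 1 + cl (card H) = cl (order G)"
  using H
proof (induction "card (carrier G) - card H" arbitrary: H rule: less_induct)
  case less
  show ?case
  proof (cases "H = carrier G")
    case True
    then show ?thesis using less.prems by (intro exI[of _ "[H]"]) (auto simp: order_def)
  next
    case False
    obtain K p where K: "subgroup K G" "H \<subset> K" "prime p" "card K = p * card H"
      using prime_index_extension[OF fin less.prems False] by blast
    have KG: "K \<subseteq> carrier G" using K subgroup.subset by blast
    then have "card K \<le> card (carrier G)" "finite K"
      using fin by (auto intro: card_mono dest: finite_subset)
    moreover have "card H < card K" using \<open>finite K\<close> K(2) by (rule psubset_card_mono)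
    ultimately have "card (carrier G) - card K < card (carrier G) - card H" by simp
    then obtain Hs where Hs: "Hs \<noteq> []" "hd Hs = K" "last Hs = carrier G"
        "\<forall>i < length Hs. subgroup (Hs ! i) G" "\<forall>i. Suc i < length Hs \<longrightarrow> Hs ! i \<subset> Hs ! Suc i"
        "length Hs - 1 + cl (card K) = cl (order G)"
      using less.hyps[OF _ K(1)] by blast
    have "card H \<noteq> 0"
      using less.prems fin by (metis card_0_eq finite_subset subgroup.subset subgroup.one_closed empty_iff)
    then have "cl (card K) = Suc (cl (card H))" using K by (simp add: cl_mult cl_prime)
    moreover have "Hs ! 0 = K" using Hs by (simp add: hd_conv_nth)
    ultimately show ?thesis
      using Hs K less.prems
      by (intro exI[of _ "H # Hs"]) (auto simp: nth_Cons split: nat.splits simp flip: length_greater_0_conv)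
  qed
qed

text \<open>The Lagrange bound also makes the set of chain lengths finite, so that
  \<open>Max\<close> is meaningful; the prime-index chain attains it.\<close>

lemma composition_length_eq_cl_order:
  assumes "comm_group G" and fin: "finite (carrier G)"
  shows "composition_length G = cl (order G)"
proof -
  interpret comm_group G by fact
  obtain Hs where Hs: "Hs \<noteq> []" "hd Hs = {\<one>\<^bsub>G\<^esub>}" "last Hs = carrier G"
    "\<forall>i < length Hs. subgroup (Hs ! i) G" "\<forall>i. Suc i < length Hs \<longrightarrow> Hs ! i \<subset> Hs ! Suc i"
    "length Hs - 1 = cl (order G)"
    using subgroup_chain_exists[OF fin triv_subgroup] by auto
  have le: "length Ks - 1 \<le> cl (order G)"
    if "Ks \<noteq> []" "last Ks = carrier G" "\<forall>i < length Ks. subgroup (Ks ! i) G"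
      "\<forall>i. Suc i < length Ks \<longrightarrow> Ks ! i \<subset> Ks ! Suc i" for Ks
    using cl_card_subgroup_chain[OF fin, of Ks "length Ks - 1"] that
    by (auto simp: last_conv_nth order_def)
  show ?thesis
    unfolding composition_length_def
  proof (rule Max_eqI)
    show "finite {length Hs - 1 | Hs. Hs \<noteq> [] \<and> hd Hs = {\<one>\<^bsub>G\<^esub>} \<and> last Hs = carrier G \<and>
      (\<forall>i < length Hs. subgroup (Hs ! i) G) \<and> (\<forall>i. Suc i < length Hs \<longrightarrow> Hs ! i \<subset> Hs ! Suc i)}"
      by (rule finite_subset[of _ "{..cl (order G)}"]) (use le in auto)
  qed (use Hs le in \<open>auto intro!: exI[of _ Hs]\<close>)
qed

section \<open>Perron vectors of weakly irreducible tensors\<close>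

lemma finite_idx [simp]: "finite (idx k n)"
proof -
  have "idx k n = {is. set is \<subseteq> {..<n} \<and> length is = k}" by (auto simp: idx_def)
  then show ?thesis by (simp add: finite_lists_length_eq)
qed

lemma idx_nth_less: "is \<in> idx k n \<Longrightarrow> j \<in> set is \<Longrightarrow> j < n"
  by (auto simp: idx_def)

lemma tensor_arcs_less: "(i, j) \<in> tensor_arcs A m n \<Longrightarrow> i < n \<and> j < n"
  by (auto simp: tensor_arcs_def idx_def)

lemma prod_list_map_nonneg:
  fixes x :: "'a \<Rightarrow> real"
  shows "(\<And>j. j \<in> set js \<Longrightarrow> 0 \<le> x j) \<Longrightarrow> 0 \<le> prod_list (map x js)"
  by (induction js) auto

lemma prod_list_map_pos:
  fixes x :: "'a \<Rightarrow> real"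
  shows "(\<And>j. j \<in> set js \<Longrightarrow> 0 < x j) \<Longrightarrow> 0 < prod_list (map x js)"
  by (induction js) auto

lemma prod_list_map_mono:
  fixes x y :: "'a \<Rightarrow> real"
  assumes "\<And>j. j \<in> set js \<Longrightarrow> 0 \<le> x j \<and> x j \<le> y j"
  shows "prod_list (map x js) \<le> prod_list (map y js)"
  using assms
proof (induction js)
  case (Cons j js)
  then show ?case
    by (auto intro!: mult_mono prod_list_map_nonneg intro: order_trans)
qed simp

lemma prod_list_map_strict_mono:
  fixes x y :: "'a \<Rightarrow> real"
  assumes "\<And>j. j \<in> set js \<Longrightarrow> 0 \<le> x j \<and> x j \<le> y j \<and> 0 < y j"
    and "j0 \<in> set js" "x j0 < y j0"
  shows "prod_list (map x js) < prod_list (map y js)"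
  using assms
proof (induction js)
  case (Cons j js)
  have le: "prod_list (map x js) \<le> prod_list (map y js)"
    using Cons.prems by (intro prod_list_map_mono) auto
  have p: "0 < prod_list (map y js)"
    using Cons.prems by (intro prod_list_map_pos) auto
  have nn: "0 \<le> prod_list (map x js)"
    using Cons.prems by (intro prod_list_map_nonneg) auto
  show ?case
  proof (cases "x j < y j")
    case True
    have "x j * prod_list (map x js) \<le> x j * prod_list (map y js)"
      using le Cons.prems by (intro mult_left_mono) auto
    also have "\<dots> < y j * prod_list (map y js)"
      using True p by (intro mult_strict_right_mono) auto
    finally show ?thesis by simp
  next
    case False
    then have "j0 \<in> set js" using Cons.prems by auto
    then have "prod_list (map x js) < prod_list (map y js)"
      using Cons by auto
    moreover have "x j = y j" "y j > 0" using False Cons.prems(1)[of j] by auto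
    ultimately show ?thesis by simp
  qed
qed simp

text \<open>The remaining factors are at least 1. This lets a bound on a monomial pass to each
  variable occurring in it.\<close>

lemma prod_list_map_ge_member:
  fixes x :: "'a \<Rightarrow> real"
  assumes "\<And>j. j \<in> set js \<Longrightarrow> 1 \<le> x j" "j \<in> set js"
  shows "x j \<le> prod_list (map x js)"
proof -
  have ge1: "1 \<le> prod_list (map x ks)" if "\<And>j. j \<in> set ks \<Longrightarrow> 1 \<le> x j" for ks
    using that
  proof (induction ks)
    case (Cons k ks)
    then have "1 * 1 \<le> x k * prod_list (map x ks)" by (intro mult_mono) (auto intro: order_trans[OF zero_le_one])
    then show ?case by simp
  qed simp
  from assms show ?thesis
  proof (induction js)
    case (Cons k js)
    have g: "1 \<le> prod_list (map x js)" "1 \<le> x k" using Cons.prems ge1 by auto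
    show ?case
    proof (cases "j = k")
      case True
      then show ?thesis using g mult_left_mono[of 1 "prod_list (map x js)" "x k"] by auto
    next
      case False
      then have "x j \<le> prod_list (map x js)" using Cons by auto
      also have "\<dots> \<le> x k * prod_list (map x js)"
        using g mult_right_mono[of 1 "x k" "prod_list (map x js)"] by auto
      finally show ?thesis by simp
    qed
  qed simp
qed

lemma prod_list_map_mult:
  fixes x y :: "'a \<Rightarrow> 'b::comm_monoid_mult"
  shows "prod_list (map (\<lambda>i. x i * y i) js) = prod_list (map x js) * prod_list (map y js)"
  by (induction js) (auto simp: mult_ac)

lemma prod_list_map_const: "prod_list (map (\<lambda>i. c) js) = c ^ length js"
  by (induction js) auto

section \<open>The tensor map on real vectors\<close>

definition real_tensor_apply ::
    "(nat list \<Rightarrow> real) \<Rightarrow> nat \<Rightarrow> nat \<Rightarrow> (nat \<Rightarrow> real) \<Rightarrow> nat \<Rightarrow> real" where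
  "real_tensor_apply A m n x i = (\<Sum>is \<in> idx (m - 1) n. A (i # is) * prod_list (map x is))"

lemma real_tensor_apply_cong:
  assumes "\<And>j. j < n \<Longrightarrow> x j = y j"
  shows "real_tensor_apply A m n x i = real_tensor_apply A m n y i"
  unfolding real_tensor_apply_def
  using assms by (intro sum.cong refl arg_cong2[where f = "(*)"] arg_cong[where f = prod_list])
    (auto dest: idx_nth_less)

lemma real_tensor_apply_scale:
  "real_tensor_apply A m n (\<lambda>i. c * x i) i = c ^ (m - 1) * real_tensor_apply A m n x i"
  unfolding real_tensor_apply_def sum_distrib_left
  by (intro sum.cong refl) (auto simp: prod_list_map_mult prod_list_map_const idx_def)

lemma tensor_apply_of_real:
  assumes "\<And>j. j < n \<Longrightarrow> z j = complex_of_real (x j)"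
  shows "tensor_apply A m n z i = complex_of_real (real_tensor_apply A m n x i)"
proof -
  have "prod_list (map z is) = complex_of_real (prod_list (map x is))"
    if "set is \<subseteq> {..<n}" for "is"
    using that assms by (induction "is") auto
  then show ?thesis
    unfolding tensor_apply_def real_tensor_apply_def by (auto simp: idx_def intro!: sum.cong)
qed

lemma continuous_on_prod_list:
  "continuous_on S (\<lambda>z. prod_list (map (f z) js))"
  if "\<And>j. continuous_on S (\<lambda>z. f z j)" for f :: "'a::topological_space \<Rightarrow> nat \<Rightarrow> real"
  by (induction js) (auto intro!: continuous_intros that)

text \<open>Tychonoff's theorem: vectors are functions on all of nat, so boxes are infinite products
  and carry the product topology.\<close>

lemma compact_box_fun:
  fixes a b :: "nat \<Rightarrow> real"
  shows "compact {x. \<forall>i. a i \<le> x i \<and> x i \<le> b i}"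
proof -
  have eq: "{x. \<forall>i. a i \<le> x i \<and> x i \<le> b i} = PiE UNIV (\<lambda>i. {a i..b i})"
    by (auto simp: PiE_def Pi_def)
  have "compactin (product_topology (\<lambda>_. euclidean) UNIV) (PiE UNIV (\<lambda>i. {a i..b i}))"
    unfolding compactin_PiE by simp
  then have "compactin euclidean (PiE UNIV (\<lambda>i. {a i..b i}))"
    by (simp only: euclidean_product_topology)
  then show ?thesis
    by (simp only: eq compactin_euclidean_iff)
qed

section \<open>Existence of a positive eigenvector\<close>

locale weakly_irreducible_tensor =
  fixes A :: "nat list \<Rightarrow> real" and m n :: nat
  assumes order_ge_2: "2 \<le> m" and dim_pos: "0 < n"
    and nonneg: "nonneg_tensor A m n"
    and irreducible: "weakly_irreducible A m n"
begin

abbreviation "F \<equiv> real_tensor_apply A m n"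

lemma entry_nonneg: "i < n \<Longrightarrow> is \<in> idx (m - 1) n \<Longrightarrow> 0 \<le> A (i # is)"
  using nonneg order_ge_2 by (auto simp: nonneg_tensor_def idx_def)

lemma F_nonneg:
  assumes "i < n" "\<And>j. j < n \<Longrightarrow> 0 \<le> x j"
  shows "0 \<le> F x i"
  unfolding real_tensor_apply_def
  by (intro sum_nonneg mult_nonneg_nonneg entry_nonneg prod_list_map_nonneg assms)
    (auto simp: idx_def)

lemma F_mono:
  assumes "i < n" "\<And>j. j < n \<Longrightarrow> 0 \<le> x j \<and> x j \<le> y j"
  shows "F x i \<le> F y i"
  unfolding real_tensor_apply_def
  by (intro sum_mono mult_left_mono entry_nonneg prod_list_map_mono assms)
    (auto simp: idx_def)

text \<open>An arc (i, j) provides a monomial of coordinate i of the tensor map that has a positive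
  coefficient and contains the variable j.\<close>

lemma F_strict_mono:
  assumes arc: "(i, j) \<in> tensor_arcs A m n"
    and xy: "\<And>k. k < n \<Longrightarrow> 0 \<le> x k \<and> x k \<le> y k \<and> 0 < y k" and less: "x j < y j"
  shows "F x i < F y i"
proof -
  obtain "is" where i: "i < n" and "is": "is \<in> idx (m - 1) n" "A (i # is) \<noteq> 0" "j \<in> set is"
    using arc by (auto simp: tensor_arcs_def)
  show ?thesis
    unfolding real_tensor_apply_def
  proof (rule sum_strict_mono_ex1)
    show "\<forall>is\<in>idx (m - 1) n. A (i # is) * prod_list (map x is) \<le> A (i # is) * prod_list (map y is)"
      using xy i by (auto intro!: mult_left_mono entry_nonneg prod_list_map_mono simp: idx_def subset_eq)
    have "0 < A (i # is)" using entry_nonneg[OF i "is"(1)] "is"(2) by simp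
    moreover have "prod_list (map x is) < prod_list (map y is)"
      using "is" xy less by (intro prod_list_map_strict_mono[of _ _ _ j]) (auto dest: idx_nth_less)
    ultimately show "\<exists>is\<in>idx (m - 1) n.
        A (i # is) * prod_list (map x is) < A (i # is) * prod_list (map y is)"
      using "is"(1) by (intro bexI[of _ "is"]) auto
  qed simp
qed

text \<open>The form in which most later arguments use weak irreducibility: a nonempty set of
  indices that arcs cannot leave is everything.\<close>

lemma set_closed_under_arcs:
  assumes "T \<subseteq> {..<n}" "T \<noteq> {}"
    and closed: "\<And>i j. i \<in> T \<Longrightarrow> (i, j) \<in> tensor_arcs A m n \<Longrightarrow> j \<in> T"
  shows "T = {..<n}"
proof -
  obtain i where i: "i \<in> T" using assms by auto
  have "j \<in> T" if "(i, j) \<in> (tensor_arcs A m n)\<^sup>*" for j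
    using that by (induction rule: rtrancl_induct) (auto intro: i closed)
  then show ?thesis
    using assms(1) i irreducible by (auto simp: weakly_irreducible_def)
qed

text \<open>Induction along a path: if x_j \<le> K, then F x j \<le> t K^(m-1), and an arc (j, k)
  gives a monomial of F x j containing x_k whose other factors are at least 1. Hence x_k is bounded
  as well.\<close>

lemma sublevel_coordinate_bound:
  assumes "(i, j) \<in> (tensor_arcs A m n)\<^sup>*" and t: "0 \<le> t"
  shows "\<exists>K. \<forall>x. (\<forall>k < n. 1 \<le> x k \<and> F x k \<le> t * x k ^ (m - 1)) \<longrightarrow> x i \<le> 1 \<longrightarrow> x j \<le> K"
  using assms(1)
proof (induction rule: rtrancl_induct)
  case (step j k)
  then obtain K where K: "\<And>x. (\<forall>k < n. 1 \<le> x k \<and> F x k \<le> t * x k ^ (m - 1)) \<Longrightarrow> x i \<le> 1 \<Longrightarrow> x j \<le> K"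
    by blast
  obtain "is" where j: "j < n" and "is": "is \<in> idx (m - 1) n" "A (j # is) \<noteq> 0" "k \<in> set is"
    using step.hyps(2) by (auto simp: tensor_arcs_def)
  have a: "0 < A (j # is)" using entry_nonneg[OF j "is"(1)] "is"(2) by simp
  have "x k \<le> t * K ^ (m - 1) / A (j # is)"
    if x: "\<forall>k < n. 1 \<le> x k \<and> F x k \<le> t * x k ^ (m - 1)" and "x i \<le> 1" for x
  proof -
    have xp: "\<And>js l. js \<in> idx (m - 1) n \<Longrightarrow> l \<in> set js \<Longrightarrow> 1 \<le> x l" using x by (auto dest: idx_nth_less)
    have "A (j # is) * x k \<le> A (j # is) * prod_list (map x is)"
      using a "is" xp by (intro mult_left_mono prod_list_map_ge_member) auto
    also have "\<dots> \<le> F x j"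
      unfolding real_tensor_apply_def
      by (rule member_le_sum[where f = "\<lambda>is. A (j # is) * prod_list (map x is)"])
        (use "is" j xp in \<open>auto intro!: mult_nonneg_nonneg entry_nonneg prod_list_map_nonneg
           intro: order_trans[OF zero_le_one]\<close>)
    also have "\<dots> \<le> t * x j ^ (m - 1)" using x j by auto
    also have "\<dots> \<le> t * K ^ (m - 1)"
      using K[OF x that(2)] x j t by (intro mult_left_mono power_mono) (auto intro: order_trans[OF zero_le_one])
    finally show ?thesis using a by (simp add: field_simps)
  qed
  then show ?case by blast
qed auto

lemma sublevel_bounded:
  assumes t: "0 \<le> t"
  obtains K where "1 \<le> K"
    "\<And>x i j. (\<forall>k < n. 1 \<le> x k \<and> F x k \<le> t * x k ^ (m - 1)) \<Longrightarrow> i < n \<Longrightarrow> x i \<le> 1 \<Longrightarrow> j < n \<Longrightarrow> x j \<le> K"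
proof -
  have "\<forall>p \<in> {..<n} \<times> {..<n}. \<exists>K. \<forall>x. (\<forall>k < n. 1 \<le> x k \<and> F x k \<le> t * x k ^ (m - 1)) \<longrightarrow>
      x (fst p) \<le> 1 \<longrightarrow> x (snd p) \<le> K"
    using irreducible sublevel_coordinate_bound[OF _ t] unfolding weakly_irreducible_def by auto
  then obtain K where "\<forall>p \<in> {..<n} \<times> {..<n}. \<forall>x. (\<forall>k < n. 1 \<le> x k \<and> F x k \<le> t * x k ^ (m - 1)) \<longrightarrow>
      x (fst p) \<le> 1 \<longrightarrow> x (snd p) \<le> K p"
    unfolding bchoice_iff by blast
  then have K: "x j \<le> K (i, j)"
    if "i < n" "j < n" "\<forall>k < n. 1 \<le> x k \<and> F x k \<le> t * x k ^ (m - 1)" "x i \<le> 1" for i j x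
    using that by (auto dest!: bspec[of _ _ "(i, j)"])
  define M where "M = Max (insert 1 (K ` ({..<n} \<times> {..<n})))"
  have M: "1 \<le> M" "\<And>i j. i < n \<Longrightarrow> j < n \<Longrightarrow> K (i, j) \<le> M" by (auto simp: M_def)
  show thesis
    by (rule that[OF M(1)]) (meson K M(2) order_trans)
qed

text \<open>The optimal value is attained because the vectors with minimal coordinate 1 in a
  sublevel set are bounded.\<close>

lemma optimal_super_eigenvalue:
  obtains \<rho> u where "0 \<le> \<rho>" "\<And>i. i < n \<Longrightarrow> 0 < u i" "\<And>i. i < n \<Longrightarrow> F u i \<le> \<rho> * u i ^ (m - 1)"
    "\<And>x t. (\<And>i. i < n \<Longrightarrow> 0 < x i) \<Longrightarrow> 0 \<le> t \<Longrightarrow> (\<And>i. i < n \<Longrightarrow> F x i \<le> t * x i ^ (m - 1)) \<Longrightarrow> \<rho> \<le> t"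
proof -
  \<comment> \<open>A value of t for which the constant vector 1 is admissible; the minimization may
    be confined to t in [0, T].\<close>
  define T where "T = (\<Sum>i<n. F (\<lambda>_. 1) i)"
  have T0: "0 \<le> T" unfolding T_def by (intro sum_nonneg F_nonneg) auto
  have FT: "F (\<lambda>_. 1) i \<le> T" if "i < n" for i
    unfolding T_def by (rule member_le_sum) (use that in \<open>auto intro!: F_nonneg\<close>)
  obtain K where K1: "1 \<le> K" and K: "\<And>x i j. (\<forall>k < n. 1 \<le> x k \<and> F x k \<le> T * x k ^ (m - 1)) \<Longrightarrow>
      i < n \<Longrightarrow> x i \<le> 1 \<Longrightarrow> j < n \<Longrightarrow> x j \<le> K"
    using sublevel_bounded[OF T0] by blast
  \<comment> \<open>The coordinates from n on are pinned to 1, so that this set of functions on all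
    of nat is compact.\<close>
  define S where "S = ({x. \<forall>i. 1 \<le> x i \<and> x i \<le> (if i < n then K else 1)} \<times> {0..T}) \<inter>
    (\<Inter>i<n. {(x, t). F x i \<le> t * x i ^ (m - 1)})"
  have cont: "continuous_on UNIV (\<lambda>z :: (nat \<Rightarrow> real) \<times> real. fst z j)" for j
    by (rule continuous_on_product_then_coordinatewise) (intro continuous_intros)
  have cl: "closed {(x, t). F x i \<le> t * x i ^ (m - 1)}" for i
  proof -
    have "closed {z :: (nat \<Rightarrow> real) \<times> real. F (fst z) i \<le> snd z * fst z i ^ (m - 1)}"
      unfolding real_tensor_apply_def
      by (intro closed_Collect_le continuous_intros continuous_on_prod_list cont)
    then show ?thesis by (simp add: case_prod_unfold)
  qed
  have "compact S" unfolding S_def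
    by (intro compact_Int_closed compact_Times compact_box_fun closed_INT ballI cl) auto
  moreover have "((\<lambda>_. 1), T) \<in> S" using K1 T0 FT by (auto simp: S_def)
  then have "S \<noteq> {}" by blast
  ultimately obtain z where z: "z \<in> S" "\<And>y. y \<in> S \<Longrightarrow> snd z \<le> snd y"
    using continuous_attains_inf[of S snd, OF _ _ continuous_on_snd[OF continuous_on_id]] by blast
  obtain u \<rho> where z_eq: "z = (u, \<rho>)" by force
  have \<rho>0: "0 \<le> \<rho>" and \<rho>T: "\<rho> \<le> T" and u1: "\<And>i. 1 \<le> u i"
    and Fu: "\<And>i. i < n \<Longrightarrow> F u i \<le> \<rho> * u i ^ (m - 1)"
    using z(1) unfolding S_def z_eq by simp_all
  show thesis
  proof (rule that[of \<rho> u])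
    show "0 \<le> \<rho>" by (rule \<rho>0)
    show "0 < u i" for i using u1[of i] by linarith
    show "F u i \<le> \<rho> * u i ^ (m - 1)" if "i < n" for i using that by (rule Fu)
    fix x t assume x: "\<And>i. i < n \<Longrightarrow> 0 < x i" and t: "0 \<le> t"
      and le: "\<And>i. i < n \<Longrightarrow> F x i \<le> t * x i ^ (m - 1)"
    show "\<rho> \<le> t"
    proof (cases "t \<le> T")
      case True
      \<comment> \<open>By homogeneity x can be rescaled so that its least coordinate is 1; the
        rescaled vector then obeys the bound K and competes in S.\<close>
      define \<mu> where "\<mu> = Min (x ` {..<n})"
      have "\<mu> \<in> x ` {..<n}" unfolding \<mu>_def using dim_pos by (intro Min_in) auto
      then obtain i0 where i0: "i0 < n" "x i0 = \<mu>" by auto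
      have \<mu>: "0 < \<mu>" using x[OF i0(1)] i0(2) by simp
      have \<mu>_le: "\<mu> \<le> x i" if "i < n" for i using that by (auto simp: \<mu>_def)
      define w where "w = (\<lambda>i. if i < n then inverse \<mu> * x i else 1)"
      have w1: "1 \<le> w i" for i using \<mu> \<mu>_le by (auto simp: w_def field_simps)
      have Fw: "F w i \<le> t * w i ^ (m - 1)" if "i < n" for i
      proof -
        have "F w i = F (\<lambda>i. inverse \<mu> * x i) i"
          by (rule real_tensor_apply_cong) (simp add: w_def)
        also have "\<dots> = inverse \<mu> ^ (m - 1) * F x i" by (rule real_tensor_apply_scale)
        also have "\<dots> \<le> inverse \<mu> ^ (m - 1) * (t * x i ^ (m - 1))"
          using \<mu> le[OF that] by (intro mult_left_mono) auto
        also have "\<dots> = t * w i ^ (m - 1)" using that by (simp add: w_def power_mult_distrib)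
        finally show ?thesis .
      qed
      have "w j \<le> K" if "j < n" for j
      proof (rule K[of w i0 j])
        show "\<forall>k<n. 1 \<le> w k \<and> F w k \<le> T * w k ^ (m - 1)"
        proof (intro allI impI conjI w1)
          fix k assume "k < n"
          then have "F w k \<le> t * w k ^ (m - 1)" by (rule Fw)
          also have "\<dots> \<le> T * w k ^ (m - 1)"
            using True order_trans[OF zero_le_one w1] by (intro mult_right_mono) auto
          finally show "F w k \<le> T * w k ^ (m - 1)" .
        qed
        show "w i0 \<le> 1" using i0 \<mu> by (simp add: w_def)
      qed (use i0 that in auto)
      then have "(w, t) \<in> S"
        using w1 Fw t True unfolding S_def by (simp add: w_def)
      then show ?thesis using z(2) z_eq by fastforce
    qed (use \<rho>T in simp)
  qed
qed

text \<open>Shrinking an optimal super-eigenvector on its set of strict coordinates enlarges that set,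
  since some arc enters it; if all coordinates were strict, the eigenvalue could be lowered.\<close>

lemma positive_eigenvector:
  obtains \<rho> v where "0 \<le> \<rho>" "\<And>i. i < n \<Longrightarrow> 0 < v i" "v 0 = 1"
    "\<And>i. i < n \<Longrightarrow> F v i = \<rho> * v i ^ (m - 1)"
proof -
  obtain \<rho> u where \<rho>: "0 \<le> \<rho>"
    and u: "\<And>i. i < n \<Longrightarrow> 0 < u i" "\<And>i. i < n \<Longrightarrow> F u i \<le> \<rho> * u i ^ (m - 1)"
    and opt: "\<And>x t. (\<And>i. i < n \<Longrightarrow> 0 < x i) \<Longrightarrow> 0 \<le> t \<Longrightarrow> (\<And>i. i < n \<Longrightarrow> F x i \<le> t * x i ^ (m - 1)) \<Longrightarrow> \<rho> \<le> t"
    using optimal_super_eigenvalue by blast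
  define good where "good x \<longleftrightarrow> (\<forall>i < n. 0 < x i \<and> F x i \<le> \<rho> * x i ^ (m - 1))" for x
  define str where "str x = {i. i < n \<and> F x i < \<rho> * x i ^ (m - 1)}" for x
  have fin: "finite (str x)" for x by (auto simp: str_def)
  have card_le: "card (str x) \<le> n" for x
    using card_mono[of "{..<n}" "str x"] by (auto simp: str_def)
  have "\<exists>x. good x \<and> str x = {}"
  proof (rule ccontr)
    assume *: "\<nexists>x. good x \<and> str x = {}"
    \<comment> \<open>Among the positive super-eigenvectors for \<open>\<rho>\<close>, one with the
      most strict coordinates is chosen. \<open>Suc n\<close> appears because the selection rule
      wants a strict upper bound on the count.\<close>
    have "good u" using u by (auto simp: good_def)
    then obtain x where x: "good x" and xmax: "\<And>y. good y \<Longrightarrow> card (str y) \<le> card (str x)"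
      using ex_has_greatest_nat[of good u "\<lambda>y. card (str y)" "Suc n"] card_le less_Suc_eq_le by blast
    have ne: "str x \<noteq> {}" using * x by auto
    have xp: "\<And>i. i < n \<Longrightarrow> 0 < x i" and xF: "\<And>i. i < n \<Longrightarrow> F x i \<le> \<rho> * x i ^ (m - 1)"
      using x by (auto simp: good_def)
    show False
    proof (cases "str x = {..<n}")
      case True
      \<comment> \<open>All quotients lie strictly below \<open>\<rho>\<close>, hence so does their
        maximum t; as t is admissible for x, this contradicts optimality.\<close>
      define t where "t = Max ((\<lambda>i. F x i / x i ^ (m - 1)) ` {..<n})"
      have t_ge: "F x i / x i ^ (m - 1) \<le> t" if "i < n" for i using that by (auto simp: t_def)
      have "t \<in> (\<lambda>i. F x i / x i ^ (m - 1)) ` {..<n}" unfolding t_def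
        using dim_pos by (intro Max_in) auto
      then obtain i where i: "i < n" "t = F x i / x i ^ (m - 1)" by auto
      have "F x i < \<rho> * x i ^ (m - 1)" using True i(1) unfolding str_def by blast
      then have "t < \<rho>" using pos_divide_less_eq[OF zero_less_power[OF xp[OF i(1)]]] i(2) by metis
      moreover have "0 \<le> t" using i xp F_nonneg[of i x] by (auto simp: less_imp_le)
      moreover have "F x j \<le> t * x j ^ (m - 1)" if "j < n" for j
        using t_ge[OF that] xp[OF that] by (simp add: field_simps)
      ultimately show False using opt[of x t, OF xp] by fastforce
    next
      case False
      \<comment> \<open>Without an arc from a non-strict k to a strict i, the complement of
        \<open>str x\<close> would be closed under arcs and hence everything, although
        \<open>str x\<close> is nonempty.\<close>
      have "{..<n} - str x = {..<n}" if "\<nexists>k i. k < n \<and> k \<notin> str x \<and> i \<in> str x \<and> (k, i) \<in> tensor_arcs A m n"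
        using that False by (intro set_closed_under_arcs) (auto dest: tensor_arcs_less simp: str_def)
      then obtain k i where ki: "k < n" "k \<notin> str x" "i \<in> str x" "(k, i) \<in> tensor_arcs A m n"
        using ne by (auto simp: str_def)
      \<comment> \<open>By continuity, shrinking by a factor c slightly below 1 keeps the finitely
        many strict inequalities.\<close>
      have "\<forall>\<^sub>F c in at_left (1::real). \<forall>i \<in> str x. F x i < \<rho> * (c * x i) ^ (m - 1)"
      proof (intro eventually_ball_finite fin ballI)
        fix i assume "i \<in> str x"
        then have "F x i < \<rho> * (1 * x i) ^ (m - 1)" by (auto simp: str_def)
        moreover have "((\<lambda>c. \<rho> * (c * x i) ^ (m - 1)) \<longlongrightarrow> \<rho> * (1 * x i) ^ (m - 1)) (at_left 1)"
          by (intro tendsto_intros)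
        ultimately show "\<forall>\<^sub>F c in at_left 1. F x i < \<rho> * (c * x i) ^ (m - 1)"
          by (rule order_tendstoD(1)[rotated])
      qed
      moreover have "\<forall>\<^sub>F c in at_left (1::real). c \<in> {0<..<1}"
        by (rule eventually_at_left_real) simp
      ultimately have "\<forall>\<^sub>F c in at_left (1::real). (\<forall>i \<in> str x. F x i < \<rho> * (c * x i) ^ (m - 1)) \<and> c \<in> {0<..<1}"
        by (rule eventually_conj)
      then obtain c where c: "\<And>i. i \<in> str x \<Longrightarrow> F x i < \<rho> * (c * x i) ^ (m - 1)" "0 < c" "c < 1"
        by (auto dest!: eventually_happens)
      define y where "y = (\<lambda>i. if i \<in> str x then c * x i else x i)"
      have y: "0 < y i \<and> y i \<le> x i" if "i < n" for i
        using xp[OF that] c by (auto simp: y_def mult_le_cancel_right1)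
      have Fy: "F y i \<le> F x i" if "i < n" for i
        using that y by (intro F_mono) (auto simp: less_imp_le)
      \<comment> \<open>The arc leads from k to the shrunk coordinate i, while y_k = x_k: the left
        side drops and the right side stays, so k becomes strict.\<close>
      have "F y k < F x k"
        using y xp ki c by (intro F_strict_mono[OF ki(4)]) (auto simp: less_imp_le y_def str_def)
      then have "insert k (str x) \<subseteq> str y"
        using ki xF[of k] Fy c(1) by (auto simp: str_def y_def split: if_splits intro: le_less_trans)
      then have "card (insert k (str x)) \<le> card (str y)" by (intro card_mono fin)
      then have "card (str x) < card (str y)" using ki fin by simp
      moreover have "good y"
        unfolding good_def
      proof (intro allI impI conjI)
        fix i assume i: "i < n"
        show "F y i \<le> \<rho> * y i ^ (m - 1)"
          using order_trans[OF Fy[OF i] xF[OF i]] le_less_trans[OF Fy[OF i] c(1)]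
          by (cases "i \<in> str x") (auto simp: y_def less_imp_le)
      qed (use y in auto)
      ultimately show False using xmax[of y] by simp
    qed
  qed
  then obtain x where x: "good x" "str x = {}" by auto
  show thesis
  proof (rule that[of \<rho> "\<lambda>i. inverse (x 0) * x i"])
    have x0: "0 < x 0" using x(1) dim_pos by (auto simp: good_def)
    show "0 < inverse (x 0) * x i" if "i < n" for i using x(1) x0 that by (auto simp: good_def)
    show "inverse (x 0) * x 0 = 1" using x0 by simp
    have "F x i = \<rho> * x i ^ (m - 1)" if "i < n" for i
      using x that by (force simp: good_def str_def)
    then show "F (\<lambda>i. inverse (x 0) * x i) i = \<rho> * (inverse (x 0) * x i) ^ (m - 1)" if "i < n" for i
      using that by (simp add: real_tensor_apply_scale power_mult_distrib)
  qed (rule \<rho>)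
qed

end

context weakly_irreducible_tensor
begin

text \<open>Let c be the largest ratio w_i / v_i. Where it is attained, \<mu> (c v_i)^(m-1) \<le> F
  w i \<le> F (c v) i = \<rho> (c v_i)^(m-1). If \<mu> = \<rho>, strict monotonicity forces w and c
  v to agree at every out-neighbour of such an index, hence everywhere.\<close>

lemma comparison_with_eigenvector:
  assumes v: "\<And>i. i < n \<Longrightarrow> 0 < v i" and Fv: "\<And>i. i < n \<Longrightarrow> F v i = \<rho> * v i ^ (m - 1)"
    and w: "\<And>i. i < n \<Longrightarrow> 0 \<le> w i" and wne: "\<exists>i<n. w i \<noteq> 0"
    and Fw: "\<And>i. i < n \<Longrightarrow> \<mu> * w i ^ (m - 1) \<le> F w i"
  shows "\<mu> \<le> \<rho>" and "\<mu> = \<rho> \<Longrightarrow> \<exists>c. \<forall>i<n. w i = c * v i"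
proof -
  define c where "c = Max ((\<lambda>i. w i / v i) ` {..<n})"
  have "c \<in> (\<lambda>i. w i / v i) ` {..<n}" unfolding c_def using dim_pos by (intro Max_in) auto
  then obtain i0 where i0: "i0 < n" "c = w i0 / v i0" by auto
  have ge: "w i / v i \<le> c" if "i < n" for i using that by (auto simp: c_def)
  have le: "w i \<le> c * v i" if "i < n" for i
    using ge[OF that] v[OF that] by (simp add: pos_divide_le_eq)
  obtain i1 where i1: "i1 < n" "w i1 \<noteq> 0" using wne by auto
  then have "0 < w i1 / v i1" using w[of i1] v[of i1] by simp
  then have c: "0 < c" using ge[OF i1(1)] by linarith
  define T where "T = {i. i < n \<and> w i = c * v i}"
  have i0T: "i0 \<in> T" using i0 v[of i0] by (simp add: T_def)
  have F_le: "F w i \<le> F (\<lambda>i. c * v i) i" if "i < n" for i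
    using that w le by (intro F_mono) auto
  have Fcv: "F (\<lambda>i. c * v i) i = \<rho> * (c * v i) ^ (m - 1)" if "i < n" for i
    using Fv[OF that] by (simp add: real_tensor_apply_scale power_mult_distrib)
  have pos: "0 < (c * v i) ^ (m - 1)" if "i < n" for i
    using c v[OF that] by simp
  have "\<mu> * (c * v i0) ^ (m - 1) \<le> \<rho> * (c * v i0) ^ (m - 1)"
    using Fw[OF i0(1)] F_le[OF i0(1)] Fcv[OF i0(1)] i0T by (simp add: T_def)
  then show "\<mu> \<le> \<rho>" using pos[OF i0(1)] by (simp add: mult_le_cancel_right)
  assume "\<mu> = \<rho>"
  have "T = {..<n}"
  proof (rule set_closed_under_arcs)
    fix i j assume i: "i \<in> T" and arc: "(i, j) \<in> tensor_arcs A m n"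
    have ij: "i < n" "j < n" using tensor_arcs_less[OF arc] by auto
    have "\<not> F w i < F (\<lambda>i. c * v i) i"
      using Fw[OF ij(1)] Fcv[OF ij(1)] i \<open>\<mu> = \<rho>\<close> by (simp add: T_def)
    then have "\<not> w j < c * v j"
      using F_strict_mono[OF arc, of w "\<lambda>i. c * v i"] w le c v by auto
    then show "j \<in> T" using le[OF ij(2)] ij by (simp add: T_def)
  qed (use i0T in \<open>auto simp: T_def\<close>)
  then show "\<exists>c. \<forall>i<n. w i = c * v i" by (auto simp: T_def)
qed

text \<open>The triangle inequality: the moduli of any eigenvector are a test vector for
  \<open>comparison_with_eigenvector\<close>.\<close>

lemma eigenpair_modulus:
  assumes "is_eigenpair A m n lam x" "i < n"
  shows "cmod lam * cmod (x i) ^ (m - 1) \<le> F (\<lambda>i. cmod (x i)) i"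
proof -
  have prod: "cmod (prod_list (map x is)) = prod_list (map (\<lambda>i. cmod (x i)) is)" for "is"
    by (induction "is") (auto simp: norm_mult)
  have "cmod lam * cmod (x i) ^ (m - 1) = cmod (tensor_apply A m n x i)"
    using assms by (simp add: is_eigenpair_def norm_mult norm_power)
  also have "\<dots> \<le> (\<Sum>is \<in> idx (m - 1) n. cmod (complex_of_real (A (i # is)) * prod_list (map x is)))"
    unfolding tensor_apply_def by (rule norm_sum)
  also have "\<dots> = F (\<lambda>i. cmod (x i)) i"
    unfolding real_tensor_apply_def
    using entry_nonneg[OF assms(2)] by (intro sum.cong refl) (simp add: norm_mult prod)
  finally show ?thesis .
qed

text \<open>The spectral radius is defined as a \<open>Sup\<close>. It is identified as a maximum:
  \<open>\<rho>\<close> is itself an eigenvalue, and comparison bounds the modulus of every other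
  one.\<close>

lemma perron_vector:
  obtains v where "\<And>i. i < n \<Longrightarrow> 0 < v i" "v 0 = 1" "\<And>i. n \<le> i \<Longrightarrow> v i = 0"
    "\<And>i. i < n \<Longrightarrow> F v i = tensor_spectral_radius A m n * v i ^ (m - 1)"
    "0 \<le> tensor_spectral_radius A m n"
proof -
  obtain \<rho> u where \<rho>: "0 \<le> \<rho>" and u: "\<And>i. i < n \<Longrightarrow> 0 < u i" "u 0 = 1"
    and Fu: "\<And>i. i < n \<Longrightarrow> F u i = \<rho> * u i ^ (m - 1)"
    using positive_eigenvector by blast
  define v where "v = (\<lambda>i. if i < n then u i else 0)"
  have v: "\<And>i. i < n \<Longrightarrow> 0 < v i" "v 0 = 1" "\<And>i. n \<le> i \<Longrightarrow> v i = 0"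
    using u dim_pos by (auto simp: v_def)
  have Fv: "F v i = \<rho> * v i ^ (m - 1)" if "i < n" for i
    using Fu[OF that] that real_tensor_apply_cong[of n v u A m i] by (simp add: v_def)
  have "tensor_spectral_radius A m n = \<rho>"
    unfolding tensor_spectral_radius_def
  proof (rule cSup_eq_maximum)
    have "is_eigenpair A m n (complex_of_real \<rho>) (\<lambda>i. complex_of_real (v i))"
      unfolding is_eigenpair_def
    proof (intro conjI allI impI)
      show "\<exists>i<n. complex_of_real (v i) \<noteq> 0" using v(2) dim_pos by auto
      fix i assume "i < n"
      then show "tensor_apply A m n (\<lambda>i. complex_of_real (v i)) i
          = complex_of_real \<rho> * complex_of_real (v i) ^ (m - 1)"
        using Fv[of i] by (subst tensor_apply_of_real[of n _ v]) auto
    qed (use v(3) in \<open>simp add: cvecs_def\<close>)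
    then show "\<rho> \<in> cmod ` {lam. \<exists>x. is_eigenpair A m n lam x}"
      using \<rho> by (intro image_eqI[of _ _ "complex_of_real \<rho>"]) auto
  next
    fix r assume "r \<in> cmod ` {lam. \<exists>x. is_eigenpair A m n lam x}"
    then obtain lam x where r: "r = cmod lam" and x: "is_eigenpair A m n lam x" by auto
    show "r \<le> \<rho>" unfolding r
    proof (rule comparison_with_eigenvector(1)[of v \<rho> "\<lambda>i. cmod (x i)"])
      show "\<exists>i<n. cmod (x i) \<noteq> 0" using x by (auto simp: is_eigenpair_def)
    qed (use v Fv eigenpair_modulus[OF x] in auto)
  qed
  then show thesis using \<rho> Fv by (intro that[of v] v) simp_all
qed

end

section \<open>Stabilizing diagonal matrices and the eigenvectors for the spectral radius\<close>

definition stabilizer :: "(nat list \<Rightarrow> real) \<Rightarrow> nat \<Rightarrow> nat \<Rightarrow> (nat \<Rightarrow> complex) set" where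
  "stabilizer A m n = {d. d 0 = 1 \<and> (\<forall>i < n. d i \<noteq> 0) \<and> (\<forall>i \<ge> n. d i = 0) \<and>
      (\<forall>is \<in> idx m n. complex_of_real (A is) =
          inverse (d (hd is)) ^ (m - 1) * complex_of_real (A is) * prod_list (map d (tl is)))}"

lemma prod_list_map_eq_prod_mset:
  fixes f :: "'a \<Rightarrow> 'b::comm_monoid_mult"
  shows "prod_list (map f js) = prod_mset (image_mset f (mset js))"
  by (induction js) auto

locale symmetric_weakly_irreducible_tensor = weakly_irreducible_tensor +
  assumes csym: "comb_symmetric A m n"
begin

text \<open>Combinatorial symmetry allows any index j of the edge to be moved to the front. The
  equation for the reordered list equates d_j^(m-1) with the product of the other entries;
  multiplying by d_j makes the right side independent of j.\<close>

lemma stabilizer_edge: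
  assumes d: "d \<in> stabilizer A m n" and "is": "is \<in> idx m n" "A is \<noteq> 0" and j: "j \<in> set is"
  shows "d j ^ m = prod_list (map d is)"
proof -
  define js where "js = j # remove1 j is"
  have ms: "mset js = mset is" using j by (simp add: js_def)
  have "length js = m \<and> set js \<subseteq> {..<n}"
    using "is"(1) mset_eq_setD[OF ms] mset_eq_length[OF ms] by (simp add: idx_def)
  then have js: "js \<in> idx m n" by (simp add: idx_def)
  have nz: "A js \<noteq> 0" 
    using csym[unfolded comb_symmetric_def, rule_format, OF "is"(1) ms] "is"(2) by blast
  have jn: "j < n" using "is"(1) j by (rule idx_nth_less)
  then have dj: "d j \<noteq> 0" using d by (auto simp: stabilizer_def)
  have "complex_of_real (A js) =
      inverse (d j) ^ (m - 1) * complex_of_real (A js) * prod_list (map d (tl js))"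
    using d js by (auto simp: stabilizer_def js_def)
  then have "1 = inverse (d j) ^ (m - 1) * prod_list (map d (tl js))" using nz by simp
  then have "d j ^ (m - 1) = prod_list (map d (tl js))"
    using dj by (simp add: field_simps)
  then have "d j ^ Suc (m - 1) = prod_list (map d js)" by (simp add: js_def)
  also have "\<dots> = prod_list (map d is)" by (simp add: prod_list_map_eq_prod_mset ms)
  finally show ?thesis using order_ge_2 by simp
qed

lemma stabilizer_root_of_unity:
  assumes d: "d \<in> stabilizer A m n" and "i < n"
  shows "d i ^ m = 1"
proof -
  define T where "T = {i. i < n \<and> d i ^ m = 1}"
  have "T = {..<n}"
  proof (rule set_closed_under_arcs)
    fix i j assume i: "i \<in> T" and "(i, j) \<in> tensor_arcs A m n"
    then obtain "is" where "is": "i < n" "is \<in> idx (m - 1) n" "A (i # is) \<noteq> 0" "j \<in> set is"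
      by (auto simp: tensor_arcs_def)
    have "i # is \<in> idx m n" using "is" order_ge_2 by (auto simp: idx_def)
    then have "d i ^ m = d j ^ m"
      using stabilizer_edge[OF d, of "i # is" i] stabilizer_edge[OF d, of "i # is" j] "is" by simp
    then show "j \<in> T" using i "is" by (auto simp: T_def dest: idx_nth_less)
  qed (use d dim_pos in \<open>auto simp: T_def stabilizer_def\<close>)
  then show ?thesis using assms(2) by (auto simp: T_def)
qed

text \<open>Once the entries are known to be m-th roots of unity, d_i^(m-1) is the inverse of d_i
  and each equation says that the product along the edge is 1. In this form the set is visibly a
  group, and taking exponents makes it linear.\<close>

lemma stabilizer_iff:
  "d \<in> stabilizer A m n \<longleftrightarrow> d 0 = 1 \<and> (\<forall>i<n. d i ^ m = 1) \<and> (\<forall>i\<ge>n. d i = 0) \<and>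
     (\<forall>is \<in> idx m n. A is \<noteq> 0 \<longrightarrow> prod_list (map d is) = 1)" (is "_ \<longleftrightarrow> ?R")
proof
  assume d: "d \<in> stabilizer A m n"
  have "prod_list (map d is) = 1" if "is \<in> idx m n" "A is \<noteq> 0" for "is"
  proof -
    have "is \<noteq> []" using that(1) order_ge_2 by (auto simp: idx_def)
    then have "hd is \<in> set is" by simp
    then show ?thesis
      using stabilizer_edge[OF d that] stabilizer_root_of_unity[OF d] that idx_nth_less by metis
  qed
  then show ?R using d stabilizer_root_of_unity[OF d] by (auto simp: stabilizer_def)
next
  assume R: ?R
  have nz: "d i \<noteq> 0" if "i < n" for i
  proof
    assume "d i = 0"
    then show False using R that order_ge_2 by (auto simp: power_0_left)
  qed
  have "complex_of_real (A is) =
      inverse (d (hd is)) ^ (m - 1) * complex_of_real (A is) * prod_list (map d (tl is))"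
    if "is": "is \<in> idx m n" for "is"
  proof (cases "A is = 0")
    case False
    obtain i js where ijs: "is = i # js" using "is" order_ge_2 by (cases "is") (auto simp: idx_def)
    then have i: "i < n" using "is" by (auto simp: idx_def)
    have "d i * prod_list (map d js) = d i * d i ^ (m - 1)"
      using R "is" False i ijs order_ge_2 by (auto simp flip: power_Suc)
    then have "prod_list (map d js) = d i ^ (m - 1)" using nz[OF i] by simp
    then show ?thesis using ijs nz[OF i] by (simp add: power_inverse)
  qed simp
  then show "d \<in> stabilizer A m n" using R nz by (auto simp: stabilizer_def)
qed

lemma stabilizer_cmod: "d \<in> stabilizer A m n \<Longrightarrow> i < n \<Longrightarrow> cmod (d i) = 1"
  using stabilizer_root_of_unity[of d i] order_ge_2
  by (metis norm_power norm_one norm_ge_zero power_eq_1_iff less_le_trans pos2 not_less_zero zero_less_numeral)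

lemma stabilizer_mult:
  assumes "d \<in> stabilizer A m n" "e \<in> stabilizer A m n"
  shows "(\<lambda>i. d i * e i) \<in> stabilizer A m n"
  using assms unfolding stabilizer_iff by (auto simp: prod_list_map_mult power_mult_distrib)

lemma stabilizer_inverse:
  assumes "d \<in> stabilizer A m n"
  shows "(\<lambda>i. inverse (d i)) \<in> stabilizer A m n"
proof -
  have "prod_list (map (\<lambda>i. inverse (d i)) is) = inverse (prod_list (map d is))" for "is"
    by (induction "is") auto
  then show ?thesis using assms unfolding stabilizer_iff by (auto simp: power_inverse)
qed

lemma stabilizer_one: "(\<lambda>i. if i < n then 1 else 0) \<in> stabilizer A m n"
proof -
  have "prod_list (map (\<lambda>i. if i < n then 1 else 0 :: complex) is) = 1" if "set is \<subseteq> {..<n}" for "is"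
    using that by (induction "is") auto
  then show ?thesis unfolding stabilizer_iff using dim_pos by (auto simp: idx_def)
qed

text \<open>An eigenvector whose modulus is the Perron vector v has the form d v with unimodular d;
  equality in the triangle inequality forces d to satisfy the stabilizer equations.\<close>

lemma PV_rho_eq:
  assumes v: "\<And>i. i < n \<Longrightarrow> 0 < v i" "v 0 = 1" "\<And>i. n \<le> i \<Longrightarrow> v i = 0"
    and Fv: "\<And>i. i < n \<Longrightarrow> F v i = tensor_spectral_radius A m n * v i ^ (m - 1)"
    and \<rho>0: "0 \<le> tensor_spectral_radius A m n"
  shows "PV_rho A m n = (\<lambda>d i. d i * complex_of_real (v i)) ` stabilizer A m n"
proof (intro equalityI subsetI)
  fix y assume "y \<in> (\<lambda>d i. d i * complex_of_real (v i)) ` stabilizer A m n"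
  then obtain d where d: "d \<in> stabilizer A m n" and y: "y = (\<lambda>i. d i * complex_of_real (v i))" by auto
  have "tensor_apply A m n y i = complex_of_real (tensor_spectral_radius A m n) * y i ^ (m - 1)"
    if i: "i < n" for i
  proof -
    have "complex_of_real (A (i # is)) * prod_list (map y is) =
        d i ^ (m - 1) * complex_of_real (A (i # is) * prod_list (map v is))"
      if "is": "is \<in> idx (m - 1) n" for "is"
    proof (cases "A (i # is) = 0")
      case False
      have "i # is \<in> idx m n" using "is" i order_ge_2 by (auto simp: idx_def)
      then have "d i * prod_list (map d is) = 1" using d False by (auto simp: stabilizer_iff)
      moreover have "d i * d i ^ (m - 1) = 1"
        using stabilizer_root_of_unity[OF d i] order_ge_2 by (simp flip: power_Suc)
      ultimately have "prod_list (map d is) = d i ^ (m - 1)"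
        by (metis mult_cancel_left mult_zero_left zero_neq_one)
      moreover have "prod_list (map (\<lambda>i. complex_of_real (v i)) is) = complex_of_real (prod_list (map v is))"
        by (induction "is") auto
      ultimately show ?thesis by (simp add: y prod_list_map_mult)
    qed simp
    then have "tensor_apply A m n y i = d i ^ (m - 1) * complex_of_real (F v i)"
      unfolding tensor_apply_def real_tensor_apply_def of_real_sum sum_distrib_left
      by (intro sum.cong refl)
    then show ?thesis using Fv[OF i] by (simp add: y power_mult_distrib)
  qed
  moreover have "y 0 = 1" using d v(2) by (simp add: y stabilizer_def)
  moreover have "y \<in> cvecs n" using v(3) by (simp add: y cvecs_def)
  ultimately show "y \<in> PV_rho A m n"
    unfolding PV_rho_def is_eigenpair_def using dim_pos by force
next
  fix y assume y: "y \<in> PV_rho A m n"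
  let ?\<rho> = "tensor_spectral_radius A m n"
  have eig: "is_eigenpair A m n (complex_of_real ?\<rho>) y" and y0: "y 0 = 1"
    using y by (auto simp: PV_rho_def)
  \<comment> \<open>The equality case of the comparison; the normalization y_0 = 1 then gives c =
    1.\<close>
  have "\<exists>c. \<forall>i<n. cmod (y i) = c * v i"
  proof (rule comparison_with_eigenvector(2)[of v ?\<rho>])
    show "?\<rho> * cmod (y i) ^ (m - 1) \<le> F (\<lambda>i. cmod (y i)) i" if "i < n" for i
      using eigenpair_modulus[OF eig that] \<rho>0 by simp
    show "\<exists>i<n. cmod (y i) \<noteq> 0" using eig by (auto simp: is_eigenpair_def)
  qed (use v Fv in auto)
  then obtain c where c: "\<And>i. i < n \<Longrightarrow> cmod (y i) = c * v i" by auto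
  have "c = 1" using c[of 0] y0 v(2) dim_pos by simp
  then have cmod_y: "cmod (y i) = v i" if "i < n" for i using c that by simp
  define d where "d = (\<lambda>i. if i < n then y i / complex_of_real (v i) else 0)"
  have y_eq: "y = (\<lambda>i. d i * complex_of_real (v i))"
  proof
    fix i show "y i = d i * complex_of_real (v i)"
      using v(1)[of i] eig by (cases "i < n") (auto simp: d_def is_eigenpair_def cvecs_def)
  qed
  have cmod_d: "cmod (d i) = 1" if "i < n" for i
    using that v(1)[OF that] cmod_y[OF that] by (simp add: d_def norm_divide)
  have key: "prod_list (map d is) = d i ^ (m - 1)"
    if i: "i < n" and "is": "is \<in> idx (m - 1) n" and nz: "A (i # is) \<noteq> 0" for i "is"
  proof -
    have di: "d i \<noteq> 0" using cmod_d[OF i] by auto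
    \<comment> \<open>The eigenvalue equation, divided by the phase d_i^(m-1), becomes: the
      unimodular numbers \<open>u\<close>, with weights \<open>a\<close> \<ge> 0, sum to the total
      weight. Comparing real parts, every u of nonzero weight equals 1.\<close>
    define u where "u = (\<lambda>is. prod_list (map d is) / d i ^ (m - 1))"
    define a where "a = (\<lambda>is. A (i # is) * prod_list (map v is))"
    have cmod_u: "cmod (u is) = 1" if "is \<in> idx (m - 1) n" for "is"
    proof -
      have "cmod (prod_list (map d js)) = 1" if "set js \<subseteq> {..<n}" for js
        using that by (induction js) (auto simp: norm_mult cmod_d)
      then show ?thesis using that cmod_d[OF i] by (auto simp: u_def idx_def norm_divide norm_power)
    qed
    have a0: "0 \<le> a is" if "is \<in> idx (m - 1) n" for "is"
      unfolding a_def using that i v(1)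
      by (intro mult_nonneg_nonneg entry_nonneg prod_list_map_nonneg) (auto intro: less_imp_le dest: idx_nth_less)
    have vprod: "prod_list (map (\<lambda>i. complex_of_real (v i)) is) = complex_of_real (prod_list (map v is))" for "is"
      by (induction "is") auto
    have "(\<Sum>is \<in> idx (m - 1) n. complex_of_real (a is) * u is) = tensor_apply A m n y i / d i ^ (m - 1)"
      unfolding tensor_apply_def sum_divide_distrib
      by (intro sum.cong refl) (simp add: a_def u_def y_eq prod_list_map_mult vprod)
    also have "\<dots> = complex_of_real ?\<rho> * y i ^ (m - 1) / d i ^ (m - 1)"
      using eig i by (simp add: is_eigenpair_def)
    also have "\<dots> = complex_of_real (F v i)"
      using di Fv[OF i] by (simp add: y_eq power_mult_distrib)
    also have "F v i = (\<Sum>is \<in> idx (m - 1) n. a is)" by (simp add: real_tensor_apply_def a_def)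
    finally have "Re (\<Sum>is \<in> idx (m - 1) n. complex_of_real (a is) * u is) = (\<Sum>is \<in> idx (m - 1) n. a is)"
      by simp
    then have "(\<Sum>is \<in> idx (m - 1) n. a is * (1 - Re (u is))) = 0"
      by (simp add: right_diff_distrib sum_subtractf)
    moreover have "0 \<le> a is * (1 - Re (u is))" if "is \<in> idx (m - 1) n" for "is"
      using a0[OF that] complex_Re_le_cmod[of "u is"] cmod_u[OF that] by simp
    ultimately have "a is * (1 - Re (u is)) = 0"
      using "is" by (simp add: sum_nonneg_eq_0_iff)
    moreover have "a is \<noteq> 0"
    proof -
      have "0 < prod_list (map v is)"
        using v(1) idx_nth_less[OF "is"] by (intro prod_list_map_pos) blast
      then show ?thesis using nz by (simp add: a_def)
    qed
    ultimately have "Re (u is) = 1" by simp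
    moreover have "Re (u is) ^ 2 + Im (u is) ^ 2 = 1" using cmod_u[OF "is"] by (simp flip: cmod_power2)
    ultimately have "u is = 1" by (simp add: complex_eq_iff)
    then show ?thesis using di by (simp add: u_def)
  qed
  have "d \<in> stabilizer A m n"
    unfolding stabilizer_def
  proof (intro CollectI conjI allI impI ballI)
    show "d 0 = 1" using y0 v(2) dim_pos by (simp add: d_def)
    show "d i \<noteq> 0" if "i < n" for i using cmod_d[OF that] by auto
    show "d i = 0" if "n \<le> i" for i using that by (simp add: d_def)
    fix "is" assume "is": "is \<in> idx m n"
    obtain i js where ijs: "is = i # js" using "is" order_ge_2 by (cases "is") (auto simp: idx_def)
    then have "i < n" "js \<in> idx (m - 1) n" using "is" by (auto simp: idx_def)
    moreover from this have "d i \<noteq> 0" using cmod_d by fastforce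
    ultimately show "complex_of_real (A is) =
        inverse (d (hd is)) ^ (m - 1) * complex_of_real (A is) * prod_list (map d (tl is))"
      using key[of i js] by (cases "A is = 0") (auto simp: ijs power_inverse)
  qed
  then show "y \<in> (\<lambda>d i. d i * complex_of_real (v i)) ` stabilizer A m n"
    using y_eq by blast
qed

text \<open>Scaling by the Perron vector carries the pointwise product of stabilizer elements to the
  product of eigenvectors, so all group laws are inherited.\<close>

lemma PV_group_comm_group_card:
  shows "comm_group (PV_group A m n)" and "card (PV_rho A m n) = card (stabilizer A m n)"
proof -
  obtain v where v: "\<And>i. i < n \<Longrightarrow> 0 < v i" "v 0 = 1" "\<And>i. n \<le> i \<Longrightarrow> v i = 0"
    and Fv: "\<And>i. i < n \<Longrightarrow> F v i = tensor_spectral_radius A m n * v i ^ (m - 1)"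
    and \<rho>0: "0 \<le> tensor_spectral_radius A m n"
    using perron_vector by blast
  define h where "h = (\<lambda>d i. d i * complex_of_real (v i))"
  have PV: "PV_rho A m n = h ` stabilizer A m n"
    unfolding h_def by (rule PV_rho_eq[OF v Fv \<rho>0])
  have inj: "inj_on h (stabilizer A m n)"
  proof (rule inj_onI, rule ext)
    fix d e i assume de: "d \<in> stabilizer A m n" "e \<in> stabilizer A m n" "h d = h e"
    have "h d i = h e i" using de(3) by simp
    then show "d i = e i"
      using de(1,2) v(1)[of i] by (cases "i < n") (auto simp: h_def stabilizer_def)
  qed
  then show "card (PV_rho A m n) = card (stabilizer A m n)" unfolding PV by (rule card_image)
  define e1 where "e1 = (\<lambda>i. if i < n then 1 else 0 :: complex)"
  have e1: "e1 \<in> stabilizer A m n" unfolding e1_def by (rule stabilizer_one)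
  \<comment> \<open>The \<open>THE\<close> is resolved by uniqueness: a phase that is real and
    positive is 1, so the Perron vector is the only positive element.\<close>
  have pos: "PV_pos A m n = h e1"
    unfolding PV_pos_def
  proof (rule the_equality)
    show "h e1 \<in> PV_rho A m n \<and> (\<forall>i<n. h e1 i \<in> \<real> \<and> 0 < Re (h e1 i))"
      unfolding PV using e1 v(1) by (auto simp: h_def e1_def)
    fix y assume y: "y \<in> PV_rho A m n \<and> (\<forall>i<n. y i \<in> \<real> \<and> 0 < Re (y i))"
    then obtain d where d: "d \<in> stabilizer A m n" "y = h d" unfolding PV by auto
    have "d i = e1 i" for i
    proof (cases "i < n")
      case True
      obtain r where r: "y i = complex_of_real r" using y True by (auto elim: Reals_cases)
      have "0 < r" using y True r by auto
      have "d i = complex_of_real (r / v i)" using r d v(1)[OF True] by (simp add: h_def field_simps)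
      moreover from this have "\<bar>r / v i\<bar> = 1" using stabilizer_cmod[OF d(1) True] by (simp only: norm_of_real)
      ultimately show ?thesis using \<open>0 < r\<close> v(1)[OF True] True by (simp add: e1_def)
    qed (use d(1) in \<open>auto simp: e1_def stabilizer_def\<close>)
    then show "y = h e1" using d(2) by (metis ext)
  qed
  have mult: "PV_mult A m n (h d) (h e) = h (\<lambda>i. d i * e i)"
    if "d \<in> stabilizer A m n" "e \<in> stabilizer A m n" for d e
  proof
    fix i
    have "h x i / complex_of_real (cmod (h x i)) = x i" if "x \<in> stabilizer A m n" "i < n" for x
      using stabilizer_cmod[OF that] v(1)[OF that(2)] by (simp add: h_def norm_mult)
    then show "PV_mult A m n (h d) (h e) i = h (\<lambda>i. d i * e i) i"
      using that v(3)[of i] by (auto simp: PV_mult_def pos) (auto simp: h_def e1_def)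
  qed
  show "comm_group (PV_group A m n)"
  proof (rule comm_groupI)
    fix x y assume "x \<in> carrier (PV_group A m n)" "y \<in> carrier (PV_group A m n)"
    then obtain d e where de: "d \<in> stabilizer A m n" "e \<in> stabilizer A m n" "x = h d" "y = h e"
      by (auto simp: PV_group_def PV)
    show "x \<otimes>\<^bsub>PV_group A m n\<^esub> y \<in> carrier (PV_group A m n)"
      using de stabilizer_mult by (simp add: PV_group_def PV mult)
    show "x \<otimes>\<^bsub>PV_group A m n\<^esub> y = y \<otimes>\<^bsub>PV_group A m n\<^esub> x"
      using de by (simp add: PV_group_def mult mult.commute)
    fix z assume "z \<in> carrier (PV_group A m n)"
    then obtain f where f: "f \<in> stabilizer A m n" "z = h f" by (auto simp: PV_group_def PV)
    show "x \<otimes>\<^bsub>PV_group A m n\<^esub> y \<otimes>\<^bsub>PV_group A m n\<^esub> z = x \<otimes>\<^bsub>PV_group A m n\<^esub> (y \<otimes>\<^bsub>PV_group A m n\<^esub> z)"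
      using de f by (simp add: PV_group_def mult stabilizer_mult mult.assoc)
  next
    show "\<one>\<^bsub>PV_group A m n\<^esub> \<in> carrier (PV_group A m n)"
      using e1 by (simp add: PV_group_def PV pos)
  next
    fix x assume "x \<in> carrier (PV_group A m n)"
    then obtain d where d: "d \<in> stabilizer A m n" "x = h d" by (auto simp: PV_group_def PV)
    have "(\<lambda>i. e1 i * d i) = d" using d(1) by (auto simp: e1_def stabilizer_def)
    then show "\<one>\<^bsub>PV_group A m n\<^esub> \<otimes>\<^bsub>PV_group A m n\<^esub> x = x"
      using d e1 by (simp add: PV_group_def pos mult)
    have "(\<lambda>i. inverse (d i) * d i) = e1" using d(1) by (auto simp: e1_def stabilizer_def)
    then show "\<exists>y\<in>carrier (PV_group A m n). y \<otimes>\<^bsub>PV_group A m n\<^esub> x = \<one>\<^bsub>PV_group A m n\<^esub>"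
      using d stabilizer_inverse[OF d(1)]
      by (intro bexI[of _ "h (\<lambda>i. inverse (d i))"]) (auto simp: PV_group_def PV pos mult)
  qed
qed

end

section \<open>Kernels over the integers modulo m\<close>

text \<open>Vectors are integer functions and residues are never formed; statements over Z_m become
  congruences of integers.\<close>

definition mvmult :: "int mat \<Rightarrow> nat \<Rightarrow> (nat \<Rightarrow> int) \<Rightarrow> nat \<Rightarrow> int" where
  "mvmult M c x i = (\<Sum>j<c. M $$ (i, j) * x j)"

lemma mvmult_add: "mvmult M c (\<lambda>j. x j + y j) i = mvmult M c x i + mvmult M c y i"
  by (simp add: mvmult_def ring_distribs sum.distrib)

lemma mvmult_scale: "mvmult M c (\<lambda>j. a * x j) i = a * mvmult M c x i"
  by (simp add: mvmult_def sum_distrib_left mult_ac)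

lemma mvmult_mult:
  assumes "M \<in> carrier_mat a b" "N \<in> carrier_mat b c" "i < a"
  shows "mvmult (M * N) c x i = mvmult M b (mvmult N c x) i"
proof -
  have "mvmult (M * N) c x i = (\<Sum>j<c. \<Sum>k<b. M $$ (i, k) * N $$ (k, j) * x j)"
    unfolding mvmult_def using assms
    by (intro sum.cong refl) (auto simp: scalar_prod_def sum_distrib_right atLeast0LessThan)
  also have "\<dots> = (\<Sum>k<b. \<Sum>j<c. M $$ (i, k) * N $$ (k, j) * x j)" by (rule sum.swap)
  also have "\<dots> = mvmult M b (mvmult N c x) i"
    by (simp add: mvmult_def sum_distrib_left mult.assoc)
  finally show ?thesis .
qed

lemma mvmult_cong:
  assumes "\<And>j. j < c \<Longrightarrow> [M $$ (i, j) = N $$ (i, j)] (mod q)" "\<And>j. j < c \<Longrightarrow> [x j = y j] (mod q)"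
  shows "[mvmult M c x i = mvmult N c y i] (mod q)"
  unfolding mvmult_def using assms by (intro cong_sum cong_mult) auto

lemma mvmult_cong_0:
  assumes "\<And>j. j < c \<Longrightarrow> [x j = 0] (mod q)"
  shows "[mvmult M c x i = 0] (mod q)"
  using mvmult_cong[of c M i M q x "\<lambda>_. 0"] assms by (simp add: mvmult_def)

lemma mvmult_inverse_mod:
  assumes "M \<in> carrier_mat k k" "N \<in> carrier_mat k k" "mod_mat q (M * N) = mod_mat q (1\<^sub>m k)" "i < k"
  shows "[mvmult M k (mvmult N k x) i = x i] (mod q)"
proof -
  have "[(M * N) $$ (i, j) = 1\<^sub>m k $$ (i, j)] (mod q)" if "j < k" for j
    using arg_cong[OF assms(3), of "\<lambda>X. X $$ (i, j)"] assms that
    by (simp add: mod_mat_def cong_def)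
  then have "[mvmult (M * N) k x i = mvmult (1\<^sub>m k) k x i] (mod q)" by (intro mvmult_cong) auto
  moreover have "mvmult (1\<^sub>m k) k x i = (\<Sum>j<k. if i = j then x j else 0)"
    unfolding mvmult_def using assms(4) by (intro sum.cong) auto
  ultimately show ?thesis using assms by (simp add: mvmult_mult[of M k k N k])
qed

text \<open>The multiples of e in Z_(eq) form a copy of Z_q, and division by e is the
  isomorphism.\<close>

lemma cong_cancel_div:
  fixes a b e q :: int
  assumes "0 < e" "e dvd a" "e dvd b"
  shows "[a div e = b div e] (mod q) \<longleftrightarrow> [a = b] (mod e * q)"
proof -
  obtain a' b' where "a = e * a'" "b = e * b'" using assms by (auto elim!: dvdE)
  then show ?thesis using assms(1) by (simp add: cong_iff_dvd_diff flip: right_diff_distrib)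
qed

text \<open>Take c to be the product of the primes that divide m but not a.\<close>

lemma stable_range_one:
  fixes a b m :: int
  assumes m: "m \<noteq> 0" and unimod: "[q * a + b = 1] (mod m)"
  shows "\<exists>c. coprime (a + c * b) m"
proof -
  define c where "c = \<Prod>{p. p \<in> prime_factors m \<and> \<not> p dvd a}"
  have fin: "finite {p. p \<in> prime_factors m \<and> \<not> p dvd a}" by simp
  have "coprime (a + c * b) m"
  proof (rule ccontr)
    assume "\<not> coprime (a + c * b) m"
    then obtain e where e: "e dvd a + c * b" "e dvd m" "\<not> is_unit e" by (rule not_coprimeE)
    then have "e \<noteq> 0" using m by auto
    then obtain p where "prime p" "p dvd e" using e(3) prime_divisor_exists by blast
    then have p: "prime p" "p dvd a + c * b" "p dvd m" using e by (auto intro: dvd_trans)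
    show False
    \<comment> \<open>A prime of m dividing a divides neither c, whose prime factors avoid a, nor b,
      by unimodularity. A prime of m not dividing a divides c, so that a + c b is congruent to a
      modulo p.\<close>
    proof (cases "p dvd a")
      case True
      then have "p dvd c * b" using p(2) by (simp add: dvd_add_right_iff)
      then consider "p dvd c" | "p dvd b" using p(1) prime_dvd_mult_iff by blast
      then show False
      proof cases
        case 1
        then obtain r where r: "r \<in> prime_factors m" "\<not> r dvd a" "p dvd r"
          using p(1) fin by (auto simp: c_def prime_dvd_prod_iff)
        then have "p = r" using p(1) by (auto intro: primes_dvd_imp_eq simp: in_prime_factors_iff)
        then show False using r True by simp
      next
        case 2
        have "[q * a + b = 1] (mod p)" using unimod p(3) by (rule cong_dvd_modulus)
        moreover have "p dvd q * a + b" using 2 True by simp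
        ultimately have "p dvd 1" using cong_dvd_iff by blast
        then show False using p(1) using not_prime_unit by blast
      qed
    next
      case False
      then have "p dvd c" using p m fin unfolding c_def by (intro dvd_prodI) (auto simp: in_prime_factors_iff)
      then show False using False p(2) by (simp add: dvd_add_left_iff)
    qed
  qed
  then show ?thesis by blast
qed

text \<open>Direct sums extend by 0 and \<open>PiE\<close> extends by \<open>undefined\<close>; this
  translation imports finiteness and cardinality.\<close>

lemma zsum_carrier_bij:
  "bij_betw (\<lambda>y. restrict y {..<length ms}) (zsum_carrier ms) (PiE {..<length ms} (\<lambda>k. {0..<ms ! k}))"
proof (rule bij_betwI[where g = "\<lambda>y k. if k < length ms then y k else 0"])
  show "(\<lambda>y. restrict y {..<length ms}) \<in> zsum_carrier ms \<rightarrow> (PiE {..<length ms} (\<lambda>k. {0..<ms ! k}))"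
    by (auto simp: zsum_carrier_def)
  show "(\<lambda>y k. if k < length ms then y k else 0) \<in> (PiE {..<length ms} (\<lambda>k. {0..<ms ! k})) \<rightarrow> zsum_carrier ms"
    by (auto simp: zsum_carrier_def PiE_def Pi_def)
  show "(\<lambda>k. if k < length ms then restrict y {..<length ms} k else 0) = y" if "y \<in> zsum_carrier ms" for y
    using that by (auto simp: zsum_carrier_def)
  show "restrict (\<lambda>k. if k < length ms then y k else 0) {..<length ms} = y"
    if "y \<in> PiE {..<length ms} (\<lambda>k. {0..<ms ! k})" for y
    using that by (auto simp: PiE_def extensional_def restrict_def)
qed

lemma finite_zsum_carrier [simp]: "finite (zsum_carrier ms)"
  using bij_betw_finite[OF zsum_carrier_bij] by (auto intro: finite_PiE)

lemma card_zsum_carrier: "card (zsum_carrier ms) = (\<Prod>k<length ms. nat (ms ! k))"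
  using bij_betw_same_card[OF zsum_carrier_bij] by (simp add: card_PiE)

lemma mod_in_zsum_replicate:
  "0 < q \<Longrightarrow> (\<lambda>i. if i < n then x i mod q else 0) \<in> zsum_carrier (replicate n q)"
  by (auto simp: zsum_carrier_def)

section \<open>Kernels with the all-ones vector, in Smith coordinates\<close>

locale smith_kernel =
  fixes B P Q P' Q' :: "int mat" and m n k r :: nat and d :: "nat \<Rightarrow> nat"
  assumes m2: "2 \<le> m" and n1: "1 \<le> n"
    and B: "B \<in> carrier_mat k n"
    and P: "P \<in> carrier_mat k k" and P': "P' \<in> carrier_mat k k"
    and P'P: "mod_mat (int m) (P' * P) = mod_mat (int m) (1\<^sub>m k)"
    and Q: "Q \<in> carrier_mat n n" and Q': "Q' \<in> carrier_mat n n"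
    and QQ': "mod_mat (int m) (Q * Q') = mod_mat (int m) (1\<^sub>m n)"
    and Q'Q: "mod_mat (int m) (Q' * Q) = mod_mat (int m) (1\<^sub>m n)"
    and r_le: "r \<le> k" "r \<le> n"
    and d_range: "\<forall>i < r. 1 \<le> d i \<and> d i \<le> m - 1"
    and d_dvd: "\<forall>i. Suc i < r \<longrightarrow> d i dvd d (Suc i)"
    and d_dvd_m: "\<forall>i < r. d i dvd m"
    and snf: "mod_mat (int m) (P * B * Q) = mat k n (\<lambda>(i, j). if i = j \<and> i < r then int (d i) else 0)"
    and ones: "\<And>l. l < k \<Longrightarrow> [mvmult B n (\<lambda>_. 1) l = 0] (mod int m)"
begin

abbreviation ker :: "(nat \<Rightarrow> int) \<Rightarrow> bool" where
  "ker x \<equiv> (\<forall>l<k. [mvmult B n x l = 0] (mod int m))"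

text \<open>Both the multiplier that must kill coordinate i and the order of the resulting
  annihilator. On free coordinates the multiplier 0 is represented by m, whose annihilator is all of
  Z_m.\<close>

definition modulus :: "nat \<Rightarrow> nat" where "modulus i = (if i < r then d i else m)"

lemma modulus_dvd: "modulus i dvd m" and modulus_pos: "0 < modulus i"
  using d_dvd_m d_range m2 by (auto simp: modulus_def Suc_le_eq)

definition coords :: "(nat \<Rightarrow> int) \<Rightarrow> nat \<Rightarrow> int" where "coords x = mvmult Q' n x"

lemma Q_coords: "i < n \<Longrightarrow> [mvmult Q n (coords x) i = x i] (mod int m)"
  unfolding coords_def by (rule mvmult_inverse_mod[OF Q Q' QQ'])

lemma coords_Q: "i < n \<Longrightarrow> [coords (mvmult Q n z) i = z i] (mod int m)"
  unfolding coords_def by (rule mvmult_inverse_mod[OF Q' Q Q'Q])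

lemma snf_apply:
  assumes "i < k"
  shows "[mvmult P k (mvmult B n (mvmult Q n z)) i = (if i < r then int (d i) * z i else 0)] (mod int m)"
proof -
  have "[(P * B * Q) $$ (i, j) = (if i = j \<and> i < r then int (d i) else 0)] (mod int m)" if "j < n" for j
  proof -
    have e: "(P * B * Q) $$ (i, j) mod int m = (if i = j \<and> i < r then int (d i) else 0)"
      using arg_cong[OF snf, of "\<lambda>X. X $$ (i, j)"] assms that P B Q by (simp add: mod_mat_def)
    have "[(P * B * Q) $$ (i, j) = (P * B * Q) $$ (i, j) mod int m] (mod int m)"
      by (simp add: cong_def)
    then show ?thesis unfolding e .
  qed
  then have "[mvmult (P * B * Q) n z i
      = mvmult (mat k n (\<lambda>(i, j). if i = j \<and> i < r then int (d i) else 0)) n z i] (mod int m)"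
    using assms by (intro mvmult_cong) auto
  also have "mvmult (mat k n (\<lambda>(i, j). if i = j \<and> i < r then int (d i) else 0)) n z i
      = (\<Sum>j<n. if i = j then if i < r then int (d i) * z i else 0 else 0)"
    unfolding mvmult_def using assms by (intro sum.cong) auto
  also have "\<dots> = (if i < r then int (d i) * z i else 0)" using r_le by auto
  finally have "[mvmult (P * B * Q) n z i = (if i < r then int (d i) * z i else 0)] (mod int m)" .
  moreover have "mvmult (P * B * Q) n z i = mvmult P k (mvmult B n (mvmult Q n z)) i"
  proof -
    have "mvmult (P * B * Q) n z i = mvmult (P * B) n (mvmult Q n z) i"
      using P B Q assms by (intro mvmult_mult[of _ k n]) auto
    also have "\<dots> = mvmult P k (mvmult B n (mvmult Q n z)) i"
      using P B assms by (intro mvmult_mult[of _ k k]) auto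
    finally show ?thesis .
  qed
  ultimately show ?thesis by simp
qed

lemma ker_Q_iff: "ker (mvmult Q n z) \<longleftrightarrow> (\<forall>i<n. [int (modulus i) * z i = 0] (mod int m))"
proof
  assume ker: "ker (mvmult Q n z)"
  show "\<forall>i<n. [int (modulus i) * z i = 0] (mod int m)"
  proof (intro allI impI)
    fix i assume "i < n"
    show "[int (modulus i) * z i = 0] (mod int m)"
    proof (cases "i < r")
      case True
      then have "[mvmult P k (mvmult B n (mvmult Q n z)) i = int (d i) * z i] (mod int m)"
        using snf_apply[of i z] r_le by simp
      moreover have "[mvmult P k (mvmult B n (mvmult Q n z)) i = 0] (mod int m)"
        using ker by - (rule mvmult_cong_0, blast)
      ultimately show ?thesis using True by (auto simp: modulus_def cong_def)
    qed (simp add: modulus_def cong_def)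
  qed
next
  assume z: "\<forall>i<n. [int (modulus i) * z i = 0] (mod int m)"
  show "ker (mvmult Q n z)"
  proof (intro allI impI)
    fix l assume l: "l < k"
    have "[mvmult P k (mvmult B n (mvmult Q n z)) i = 0] (mod int m)" if "i < k" for i
      using snf_apply[OF that, of z] z r_le
      by (auto simp: modulus_def cong_def split: if_splits)
    then have "[mvmult P' k (mvmult P k (mvmult B n (mvmult Q n z))) l = 0] (mod int m)"
      by (rule mvmult_cong_0)
    then show "[mvmult B n (mvmult Q n z) l = 0] (mod int m)"
      using mvmult_inverse_mod[OF P' P P'P l] by (metis cong_sym cong_trans)
  qed
qed

lemma ker_cong: "(\<And>i. i < n \<Longrightarrow> [x i = y i] (mod int m)) \<Longrightarrow> ker x \<longleftrightarrow> ker y"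
  using mvmult_cong[of n B _ B "int m" x y] by (meson cong_refl cong_sym cong_trans)

lemma ker_iff: "ker x \<longleftrightarrow> (\<forall>i<n. [int (modulus i) * coords x i = 0] (mod int m))"
  using ker_cong[of "mvmult Q n (coords x)" x, OF Q_coords] ker_Q_iff[of "coords x"] by blast

definition ones_coords :: "nat \<Rightarrow> int" where "ones_coords = coords (\<lambda>_. 1)"

lemma modulus_ones_coords: "i < n \<Longrightarrow> [int (modulus i) * ones_coords i = 0] (mod int m)"
  using ones ker_iff[of "\<lambda>_. 1"] by (auto simp: ones_coords_def)

text \<open>If r = n, every coordinate of the all-ones vector is killed by its d_i, hence by the
  last one, a multiple of all of them. Transforming back by Q gives m dvd \<open>d (r - 1)\<close>,
  although 1 \<le> \<open>d (r - 1)\<close> < m.\<close>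

lemma r_less: "r < n"
proof (rule ccontr)
  assume "\<not> r < n"
  then have rn: "r = n" using r_le by simp
  have dvd: "d i dvd d (r - 1)" if "i < r" for i
  proof -
    have "i \<le> r - 1" using that by simp
    then show ?thesis
    proof (induction rule: inc_induct)
      case (step j)
      then have "d j dvd d (Suc j)" using d_dvd by auto
      then show ?case using step by (auto intro: dvd_trans)
    qed simp
  qed
  have "[int (d (r - 1)) * ones_coords i = 0] (mod int m)" if i: "i < n" for i
  proof -
    obtain c where c: "d (r - 1) = d i * c" using dvd[of i] i rn unfolding dvd_def by blast
    have "[int (d i) * ones_coords i = 0] (mod int m)"
      using modulus_ones_coords[OF i] i rn unfolding modulus_def by simp
    then have "[int (d i) * ones_coords i * int c = 0 * int c] (mod int m)"
      by (intro cong_mult cong_refl)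
    moreover have "int (d (r - 1)) * ones_coords i = int (d i) * ones_coords i * int c"
      by (simp only: c of_nat_mult mult_ac)
    ultimately show ?thesis by (simp only: mult_zero_left)
  qed
  then have "[mvmult Q n (\<lambda>i. int (d (r - 1)) * ones_coords i) 0 = 0] (mod int m)" by (rule mvmult_cong_0)
  moreover have "[int (d (r - 1)) * mvmult Q n ones_coords 0 = int (d (r - 1)) * 1] (mod int m)"
    using Q_coords[of 0 "\<lambda>_. 1"] n1 by (intro cong_mult) (auto simp: ones_coords_def)
  ultimately have "[int (d (r - 1)) = 0] (mod int m)"
    by (simp add: mvmult_scale) (metis cong_sym cong_trans)
  then have "m dvd d (r - 1)" by (simp add: cong_0_iff)
  moreover have "1 \<le> d (r - 1)" "d (r - 1) \<le> m - 1" using d_range rn n1 by auto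
  ultimately show False using m2 by (auto dest: dvd_imp_le)
qed

text \<open>The functional below adds multiples of the other coordinates to the last one, which is free
  since r < n, so that its value at the all-ones vector becomes a unit modulo m.\<close>

definition cut_coeff :: int where
  "cut_coeff = (SOME c. coprime (ones_coords (n - 1) + c * (\<Sum>j<n-1. Q $$ (0, j) * ones_coords j)) (int m))"

definition cut :: "(nat \<Rightarrow> int) \<Rightarrow> int" where
  "cut x = coords x (n - 1) + cut_coeff * (\<Sum>j<n-1. Q $$ (0, j) * coords x j)"

text \<open>Row 0 of Q sends the coordinates of the all-ones vector to its entry 1. Separating the
  last term yields the relation q a + b = 1 modulo m, with a the last coordinate; b is the
  combination that \<open>cut\<close> adds.\<close>

lemma coprime_cut_ones: "coprime (cut (\<lambda>_. 1)) (int m)"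
proof -
  have "[mvmult Q n ones_coords 0 = 1] (mod int m)" using Q_coords[of 0 "\<lambda>_. 1"] n1 by (simp add: ones_coords_def)
  moreover have "mvmult Q n ones_coords 0 = Q $$ (0, n - 1) * ones_coords (n - 1) + (\<Sum>j<n-1. Q $$ (0, j) * ones_coords j)"
    using n1 sum.lessThan_Suc[of "\<lambda>j. Q $$ (0, j) * ones_coords j" "n - 1"] by (simp add: mvmult_def)
  ultimately have "\<exists>c. coprime (ones_coords (n - 1) + c * (\<Sum>j<n-1. Q $$ (0, j) * ones_coords j)) (int m)"
    using m2 by (intro stable_range_one[of _ "Q $$ (0, n - 1)"]) auto
  then show ?thesis unfolding cut_coeff_def cut_def ones_coords_def[symmetric] by (rule someI_ex)
qed

definition cut_inverse :: int where "cut_inverse = (SOME a. [cut (\<lambda>_. 1) * a = 1] (mod int m))"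

lemma cut_inverse: "[cut (\<lambda>_. 1) * cut_inverse = 1] (mod int m)"
  unfolding cut_inverse_def using cong_solve_coprime_int[OF coprime_cut_ones] by (rule someI_ex)

text \<open>The coordinates of x after subtracting the multiple of the all-ones vector that makes
  \<open>cut\<close> vanish modulo m: projection along that vector.\<close>

definition residue :: "(nat \<Rightarrow> int) \<Rightarrow> nat \<Rightarrow> int" where
  "residue x i = coords x i - cut_inverse * cut x * ones_coords i"

lemma coords_add: "coords (\<lambda>j. a j + b j) i = coords a i + coords b i"
  by (simp add: coords_def mvmult_add)

lemma coords_scale: "coords (\<lambda>j. c * a j) i = c * coords a i"
  by (simp add: coords_def mvmult_scale)

lemma cut_add: "cut (\<lambda>j. a j + b j) = cut a + cut b"
  by (simp add: cut_def coords_add ring_distribs sum.distrib)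

lemma cut_scale: "cut (\<lambda>j. c * a j) = c * cut a"
  by (simp add: cut_def coords_scale ring_distribs sum_distrib_left mult_ac)

lemma residue_add: "residue (\<lambda>j. a j + b j) i = residue a i + residue b i"
  by (simp add: residue_def coords_add cut_add algebra_simps)

lemma residue_scale: "residue (\<lambda>j. c * a j) i = c * residue a i"
  by (simp add: residue_def coords_scale cut_scale algebra_simps)

lemma coords_cong: "(\<And>i. i < n \<Longrightarrow> [a i = b i] (mod int m)) \<Longrightarrow> [coords a i = coords b i] (mod int m)"
  unfolding coords_def by (intro mvmult_cong) auto

lemma residue_cong: "(\<And>i. i < n \<Longrightarrow> [a i = b i] (mod int m)) \<Longrightarrow> [residue a i = residue b i] (mod int m)"
  unfolding residue_def cut_def by (intro cong_diff cong_mult cong_add cong_sum cong_refl coords_cong)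

lemma residue_ones: "[residue (\<lambda>_. 1) i = 0] (mod int m)"
proof -
  have "[ones_coords i - cut_inverse * cut (\<lambda>_. 1) * ones_coords i = ones_coords i - 1 * ones_coords i] (mod int m)"
    using cut_inverse by (intro cong_diff cong_mult) (auto simp: mult.commute)
  then show ?thesis by (simp add: residue_def ones_coords_def)
qed

lemma modulus_residue:
  assumes "ker x" "i < n"
  shows "[int (modulus i) * residue x i = 0] (mod int m)"
proof -
  have "[int (modulus i) * coords x i - (cut_inverse * cut x) * (int (modulus i) * ones_coords i) = 0 - (cut_inverse * cut x) * 0] (mod int m)"
    using assms ker_iff[of x] modulus_ones_coords[of i] by (intro cong_diff cong_mult) auto
  then show ?thesis by (simp add: residue_def algebra_simps)
qed

text \<open>The projection e of w has n - 1 vanishing coordinates, and \<open>cut e = 0\<close>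
  forces the last to vanish too. So w is a multiple of the all-ones vector modulo m, and w_0 = 0
  kills that multiple.\<close>

lemma residue_kernel:
  assumes w0: "[w 0 = 0] (mod int m)" and fw: "\<And>i. i < n - 1 \<Longrightarrow> [residue w i = 0] (mod int m)" and "i < n"
  shows "[w i = 0] (mod int m)"
proof -
  define e where "e = (\<lambda>j. w j + (- cut_inverse * cut w) * 1)"
  have coords_e: "coords e j = residue w j" for j
    unfolding e_def coords_add coords_scale by (simp add: residue_def ones_coords_def)
  have "cut e = cut w + (- cut_inverse * cut w) * cut (\<lambda>_. 1)" unfolding e_def cut_add cut_scale ..
  also have "\<dots> = cut w - cut w * (cut (\<lambda>_. 1) * cut_inverse)" by (simp add: algebra_simps)
  also have "[\<dots> = cut w - cut w * 1] (mod int m)" by (intro cong_diff cong_mult cut_inverse cong_refl)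
  finally have "[cut e = 0] (mod int m)" by simp
  moreover have "[cut e = coords e (n - 1) + cut_coeff * 0] (mod int m)"
    unfolding cut_def
  proof (intro cong_add cong_mult cong_refl)
    have "[(\<Sum>j<n-1. Q $$ (0, j) * coords e j) = (\<Sum>j<n-1. Q $$ (0, j) * 0)] (mod int m)"
      using fw by (intro cong_sum cong_mult) (auto simp: coords_e)
    then show "[(\<Sum>j<n-1. Q $$ (0, j) * coords e j) = 0] (mod int m)" by simp
  qed
  ultimately have last: "[coords e (n - 1) = 0] (mod int m)" by (simp add: cong_def)
  have coords_e0: "[coords e j = 0] (mod int m)" if "j < n" for j
    using fw[of j] last that by (cases "j = n - 1") (auto simp: coords_e)
  have e0: "[e j = 0] (mod int m)" if "j < n" for j
    using Q_coords[OF that, of e] mvmult_cong_0[of n "coords e" "int m" Q j] coords_e0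
    by (metis cong_sym cong_trans)
  have "[e 0 - w 0 = 0 - 0] (mod int m)" using e0 w0 n1 by (intro cong_diff) auto
  then have "[e i - (e 0 - w 0) = 0 - 0] (mod int m)" using e0[OF assms(3)] by (intro cong_diff) auto
  then show ?thesis by (simp add: e_def)
qed

lemma residue_surj:
  assumes g: "\<And>i. i < n - 1 \<Longrightarrow> [int (modulus i) * g i = 0] (mod int m)"
  obtains x where "ker x" "x 0 = 0" "\<And>i. i < n - 1 \<Longrightarrow> [residue x i = g i] (mod int m)"
proof -
  \<comment> \<open>The last coordinate is chosen so that \<open>cut\<close> vanishes, hence
    projecting changes nothing. It may be chosen freely because r \<le> n - 1.\<close>
  define z where "z = (\<lambda>i. if i < n - 1 then g i else - cut_coeff * (\<Sum>j<n-1. Q $$ (0, j) * g j))"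
  define x' where "x' = mvmult Q n z"
  have z: "[int (modulus i) * z i = 0] (mod int m)" if "i < n" for i
    using that g[of i] r_less by (cases "i < n - 1") (auto simp: z_def modulus_def cong_0_iff)
  then have ker': "ker x'" unfolding x'_def using ker_Q_iff by blast
  have co': "[coords x' i = z i] (mod int m)" if "i < n" for i
    unfolding x'_def by (rule coords_Q[OF that])
  have "[cut x' = z (n - 1) + cut_coeff * (\<Sum>j<n-1. Q $$ (0, j) * z j)] (mod int m)"
    unfolding cut_def using n1 by (intro cong_add cong_mult cong_sum co' cong_refl) auto
  also have "(\<Sum>j<n-1. Q $$ (0, j) * z j) = (\<Sum>j<n-1. Q $$ (0, j) * g j)"
    by (intro sum.cong) (auto simp: z_def)
  also have "z (n - 1) + cut_coeff * (\<Sum>j<n-1. Q $$ (0, j) * g j) = 0" by (simp add: z_def)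
  finally have s': "[cut x' = 0] (mod int m)" .
  have f': "[residue x' i = g i] (mod int m)" if "i < n - 1" for i
  proof -
    have "[coords x' i - cut_inverse * cut x' * ones_coords i = z i - cut_inverse * 0 * ones_coords i] (mod int m)"
      using co'[of i] s' that by (intro cong_diff cong_mult cong_refl) auto
    then show ?thesis using that by (simp add: residue_def z_def)
  qed
  \<comment> \<open>Normalizing entry 0 by a multiple of the all-ones vector leaves the residue
    unchanged modulo m.\<close>
  define x where "x = (\<lambda>j. x' j + (- x' 0) * 1)"
  show thesis
  proof (rule that[of x])
    show "x 0 = 0" by (simp add: x_def)
    show "ker x"
    proof (intro allI impI)
      fix l assume l: "l < k"
      have "[mvmult B n x' l + (- x' 0) * mvmult B n (\<lambda>_. 1) l = 0 + (- x' 0) * 0] (mod int m)"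
        using ker' ones l by (intro cong_add cong_mult cong_refl) auto
      then show "[mvmult B n x l = 0] (mod int m)" unfolding x_def mvmult_add mvmult_scale by simp
    qed
    fix i assume i: "i < n - 1"
    have "[residue x' i + (- x' 0) * residue (\<lambda>_. 1) i = g i + (- x' 0) * 0] (mod int m)"
      using f'[OF i] residue_ones by (intro cong_add cong_mult cong_refl)
    then show "[residue x i = g i] (mod int m)" unfolding x_def residue_add residue_scale by simp
  qed
qed

text \<open>The nontrivial summands in the order of the claimed direct sum. Index n - 1 is absent:
  its copy of Z_m is the one split off.\<close>

definition idxs :: "nat list" where
  "idxs = filter (\<lambda>i. d i \<noteq> 1) [0..<r] @ [r..<n - 1]"

abbreviation moduli :: "int list" where
  "moduli \<equiv> map (\<lambda>i. int (d i)) (filter (\<lambda>i. d i \<noteq> 1) [0..<r]) @ replicate (n - 1 - r) (int m)"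

lemma moduli_eq: "moduli = map (\<lambda>i. int (modulus i)) idxs"
proof -
  have e1: "map (\<lambda>i. int (d i)) (filter (\<lambda>i. d i \<noteq> 1) [0..<r]) = map (\<lambda>i. int (modulus i)) (filter (\<lambda>i. d i \<noteq> 1) [0..<r])"
    by (auto simp: modulus_def)
  have "map (\<lambda>i. int (modulus i)) [r..<n - 1] = map (\<lambda>_. int m) [r..<n - 1]"
    by (auto simp: modulus_def)
  also have "\<dots> = replicate (n - 1 - r) (int m)" by (simp add: map_replicate_const)
  finally have e2: "map (\<lambda>i. int (modulus i)) [r..<n - 1] = replicate (n - 1 - r) (int m)" .
  show ?thesis unfolding idxs_def map_append e1 e2 ..
qed

lemma idxs: "distinct idxs" "set idxs \<subseteq> {..<n - 1}" "i < n - 1 \<Longrightarrow> i \<notin> set idxs \<Longrightarrow> modulus i = 1"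
  using r_less by (auto simp: idxs_def modulus_def)

definition reduced_kernel :: "(nat \<Rightarrow> int) set" where
  "reduced_kernel = {x \<in> zsum_carrier (replicate n (int m)). x 0 = 0 \<and> ker x}"

text \<open>A generator of the annihilator of \<open>modulus i\<close> in Z_m; dividing by it
  identifies this annihilator with Z_(modulus i).\<close>

definition cofactor :: "nat \<Rightarrow> int" where "cofactor i = int (m div modulus i)"

lemma cofactor: "0 < cofactor i" "int m = cofactor i * int (modulus i)"
  using modulus_dvd[of i] modulus_pos[of i] m2
  by (auto simp: cofactor_def div_greater_zero_iff dvd_imp_le simp flip: of_nat_mult)

lemma cofactor_dvd_iff: "[int (modulus i) * a = 0] (mod int m) \<longleftrightarrow> cofactor i dvd a"
  using modulus_pos[of i] by (subst cofactor(2)[of i]) (simp add: cong_0_iff mult.commute)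

definition decompose :: "(nat \<Rightarrow> int) \<Rightarrow> nat \<Rightarrow> int" where
  "decompose x h = (if h < length idxs then (residue x (idxs ! h) div cofactor (idxs ! h)) mod int (modulus (idxs ! h)) else 0)"

lemma idxs_nth_less: "h < length idxs \<Longrightarrow> idxs ! h < n - 1"
  using idxs(2) nth_mem by (metis lessThan_iff subsetD)

lemma decompose_in: "decompose x \<in> zsum_carrier moduli"
  unfolding moduli_eq using modulus_pos by (auto simp: decompose_def zsum_carrier_def)

lemma cofactor_dvd_residue: "x \<in> reduced_kernel \<Longrightarrow> i < n \<Longrightarrow> cofactor i dvd residue x i"
  using modulus_residue[of x i] cofactor_dvd_iff by (auto simp: reduced_kernel_def)

lemma decompose_cong_iff:
  assumes "x \<in> reduced_kernel" "h < length idxs" "cofactor (idxs ! h) dvd a"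
  shows "decompose x h = (a div cofactor (idxs ! h)) mod int (modulus (idxs ! h)) \<longleftrightarrow> [residue x (idxs ! h) = a] (mod int m)"
proof -
  let ?i = "idxs ! h"
  have "?i < n" using idxs_nth_less[OF assms(2)] by simp
  then show ?thesis
    using assms cofactor_dvd_residue[OF assms(1), of ?i] cofactor(1)[of ?i] 
      cong_cancel_div[of "cofactor ?i" "residue x ?i" a "int (modulus ?i)"] cofactor(2)[of ?i]
    by (simp add: decompose_def cong_def)
qed

lemma reduced_kernel_combination:
  assumes x: "x \<in> reduced_kernel" and x': "x' \<in> reduced_kernel"
  shows "(\<lambda>i. if i < n then (a * x i + b * x' i) mod int m else 0) \<in> reduced_kernel"
proof -
  have "ker (\<lambda>i. if i < n then (a * x i + b * x' i) mod int m else 0) \<longleftrightarrow> ker (\<lambda>i. a * x i + b * x' i)"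
    by (rule ker_cong) (simp add: cong_def)
  moreover have "ker (\<lambda>i. a * x i + b * x' i)"
  proof (intro allI impI)
    fix l assume "l < k"
    then have "[a * mvmult B n x l + b * mvmult B n x' l = a * 0 + b * 0] (mod int m)"
      using x x' by (intro cong_add cong_mult cong_refl) (auto simp: reduced_kernel_def)
    then show "[mvmult B n (\<lambda>i. a * x i + b * x' i) l = 0] (mod int m)"
      by (simp add: mvmult_add mvmult_scale)
  qed
  ultimately show ?thesis
    using x x' m2 n1 unfolding reduced_kernel_def by (auto intro: mod_in_zsum_replicate)
qed

text \<open>General coefficients cover both module operations: a = b = 1 for addition, b = 0 for
  scalars.\<close>

lemma decompose_combination:
  assumes x: "x \<in> reduced_kernel" and x': "x' \<in> reduced_kernel" and h: "h < length idxs"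
  shows "decompose (\<lambda>i. if i < n then (a * x i + b * x' i) mod int m else 0) h
    = (a * decompose x h + b * decompose x' h) mod int (modulus (idxs ! h))"
proof -
  let ?i = "idxs ! h"
  have i: "?i < n" using idxs_nth_less[OF h] by simp
  obtain p q where pq: "residue x ?i = cofactor ?i * p" "residue x' ?i = cofactor ?i * q"
    using cofactor_dvd_residue[OF x i] cofactor_dvd_residue[OF x' i] by (auto elim!: dvdE)
  have "[residue (\<lambda>i. if i < n then (a * x i + b * x' i) mod int m else 0) ?i = residue (\<lambda>i. a * x i + b * x' i) ?i] (mod int m)"
    by (rule residue_cong) (simp add: cong_def)
  also have "residue (\<lambda>i. a * x i + b * x' i) ?i = cofactor ?i * (a * p + b * q)"
    unfolding residue_add residue_scale pq by (simp add: algebra_simps)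
  finally have "decompose (\<lambda>i. if i < n then (a * x i + b * x' i) mod int m else 0) h = (a * p + b * q) mod int (modulus ?i)"
    using decompose_cong_iff[OF reduced_kernel_combination[OF x x', of a b] h, of "cofactor ?i * (a * p + b * q)"] cofactor(1)[of ?i]
    by simp
  moreover have "decompose x h = p mod int (modulus ?i)" "decompose x' h = q mod int (modulus ?i)"
    using h cofactor(1)[of ?i] by (simp_all add: decompose_def pq)
  moreover have "(a * (p mod int (modulus ?i)) + b * (q mod int (modulus ?i))) mod int (modulus ?i)
      = (a * p + b * q) mod int (modulus ?i)"
    by (intro mod_add_cong mod_mult_right_eq)
  ultimately show ?thesis by simp
qed

lemma bij_decompose: "bij_betw decompose reduced_kernel (zsum_carrier moduli)"
  unfolding bij_betw_def
proof
  show "inj_on decompose reduced_kernel"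
  proof (rule inj_onI)
    fix x x' assume x: "x \<in> reduced_kernel" and x': "x' \<in> reduced_kernel" and eq: "decompose x = decompose x'"
    define w where "w = (\<lambda>i. x i + (- 1) * x' i)"
    have "[residue x i = residue x' i] (mod int m)" if i: "i < n - 1" for i
    proof (cases "i \<in> set idxs")
      case True
      then obtain h where h: "h < length idxs" "i = idxs ! h" by (auto simp: in_set_conv_nth)
      then show ?thesis
        using decompose_cong_iff[OF x h(1), of "residue x' i"] cofactor_dvd_residue[OF x', of i] eq i
        by (simp add: decompose_def)
    next
      case False
      \<comment> \<open>At an omitted index the modulus is 1, so membership in the kernel alone
        makes both residues 0 modulo m.\<close>
      then have "cofactor i = int m" using idxs(3)[OF i] by (simp add: cofactor_def)
      then show ?thesis using cofactor_dvd_residue[OF x, of i] cofactor_dvd_residue[OF x', of i] i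
        by (simp add: cong_def)
    qed
    then have "[residue w i = 0] (mod int m)" if "i < n - 1" for i
      using that unfolding w_def residue_add residue_scale by (simp add: cong_iff_dvd_diff)
    moreover have "w 0 = 0" using x x' by (simp add: reduced_kernel_def w_def)
    ultimately have w: "[w i = 0] (mod int m)" if "i < n" for i
      using residue_kernel[of w i] that by simp
    show "x = x'"
    proof
      fix i show "x i = x' i"
      proof (cases "i < n")
        case True
        then have "0 \<le> x i" "x i < int m" "0 \<le> x' i" "x' i < int m"
          using x x' by (auto simp: reduced_kernel_def zsum_carrier_def)
        moreover have "[x i = x' i] (mod int m)" using w[OF True] by (simp add: w_def cong_iff_dvd_diff)
        ultimately show ?thesis by (simp add: cong_def)
      qed (use x x' in \<open>auto simp: reduced_kernel_def zsum_carrier_def\<close>)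
    qed
  qed
  show "decompose ` reduced_kernel = zsum_carrier moduli"
  proof (intro equalityI subsetI)
    fix t assume t: "t \<in> zsum_carrier moduli"
    define pos where "pos = inv_into {..<length idxs} (nth idxs)"
    have inj: "inj_on (nth idxs) {..<length idxs}" using idxs(1) by (simp add: inj_on_nth)
    have pos: "pos (idxs ! h) = h" if "h < length idxs" for h
      unfolding pos_def using that by (intro inv_into_f_f inj) auto
    \<comment> \<open>The omitted coordinates, being trivial summands, are filled with 0.\<close>
    define g where "g = (\<lambda>i. if i \<in> set idxs then cofactor i * t (pos i) else 0)"
    have g: "[int (modulus i) * g i = 0] (mod int m)" for i
      unfolding cofactor_dvd_iff by (simp add: g_def)
    obtain x where x: "ker x" "x 0 = 0" "\<And>i. i < n - 1 \<Longrightarrow> [residue x i = g i] (mod int m)"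
      using residue_surj[of g] g by blast
    define x' where "x' = (\<lambda>i. if i < n then x i mod int m else 0)"
    have cong: "[x' i = x i] (mod int m)" if "i < n" for i using that by (simp add: x'_def cong_def)
    have x'S: "x' \<in> reduced_kernel"
      using x(1,2) ker_cong[of x' x, OF cong] m2 mod_in_zsum_replicate[of "int m" n x]
      unfolding reduced_kernel_def by (auto simp: x'_def)
    have "decompose x' h = t h" for h
    proof (cases "h < length idxs")
      case True
      let ?i = "idxs ! h"
      have "[residue x' ?i = g ?i] (mod int m)"
        using residue_cong[of x' x ?i, OF cong] x(3)[OF idxs_nth_less[OF True]] by (rule cong_trans)
      moreover have gi: "g ?i = cofactor ?i * t h" using True by (simp add: g_def pos)
      ultimately have "decompose x' h = t h mod int (modulus ?i)"
        using decompose_cong_iff[OF x'S True, of "g ?i"] cofactor(1)[of ?i] by simp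
      also have "\<dots> = t h" using t True unfolding moduli_eq by (auto simp: zsum_carrier_def)
      finally show ?thesis .
    next
      case False
      then show ?thesis using t unfolding moduli_eq by (auto simp: zsum_carrier_def decompose_def)
    qed
    then have "t = decompose x'" by auto
    then show "t \<in> decompose ` reduced_kernel" using x'S by blast
  qed (use decompose_in in auto)
qed

lemma zmod_iso_reduced_kernel: "zmod_iso (replicate n (int m)) reduced_kernel moduli (zsum_carrier moduli)"
  unfolding zmod_iso_def
proof (intro exI[of _ decompose] conjI bij_decompose ballI allI)
  fix x x' assume x: "x \<in> reduced_kernel" and x': "x' \<in> reduced_kernel"
  have "zsum_add (replicate n (int m)) x x' = (\<lambda>i. if i < n then (1 * x i + 1 * x' i) mod int m else 0)"
    by (auto simp: zsum_add_def)
  then show "decompose (zsum_add (replicate n (int m)) x x') = zsum_add moduli (decompose x) (decompose x')"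
    using decompose_combination[OF x x', of _ 1 1] unfolding moduli_eq
    by (auto simp: zsum_add_def decompose_def)
next
  fix c x assume x: "x \<in> reduced_kernel"
  have "zsum_smult (replicate n (int m)) c x = (\<lambda>i. if i < n then (c * x i + 0 * x i) mod int m else 0)"
    by (auto simp: zsum_smult_def)
  then show "decompose (zsum_smult (replicate n (int m)) c x) = zsum_smult moduli c (decompose x)"
    using decompose_combination[OF x x, of _ c 0] unfolding moduli_eq
    by (auto simp: zsum_smult_def decompose_def)
qed

lemma card_reduced_kernel: "card reduced_kernel = m ^ (n - 1 - r) * (\<Prod>i<r. d i)"
proof -
  have "card reduced_kernel = (\<Prod>h<length idxs. modulus (idxs ! h))"
    using bij_betw_same_card[OF bij_decompose] unfolding moduli_eq by (simp add: card_zsum_carrier)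
  also have "\<dots> = (\<Prod>i\<in>set idxs. modulus i)"
    using idxs(1) by (intro prod.reindex_bij_betw bij_betw_nth) auto
  also have "set idxs = {i. i < r \<and> d i \<noteq> 1} \<union> {r..<n - 1}" by (auto simp: idxs_def)
  also have "prod modulus \<dots> = prod modulus {i. i < r \<and> d i \<noteq> 1} * prod modulus {r..<n - 1}"
    by (rule prod.union_disjoint) auto
  also have "prod modulus {i. i < r \<and> d i \<noteq> 1} = (\<Prod>i<r. d i)"
    by (rule prod.mono_neutral_cong_left) (auto simp: modulus_def)
  also have "prod modulus {r..<n - 1} = m ^ (n - 1 - r)" by (simp add: modulus_def)
  finally show ?thesis by simp
qed

end

section \<open>The stabilizer as a kernel\<close>

lemma sum_list_map_eq_sum_count_lessThan:
  fixes x :: "nat \<Rightarrow> int"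
  assumes "set js \<subseteq> {..<n}"
  shows "sum_list (map x js) = (\<Sum>j<n. int (count (mset js) j) * x j)"
  using assms
proof (induction js)
  case (Cons a js)
  have "(\<Sum>j<n. int (count (mset (a # js)) j) * x j)
      = (\<Sum>j<n. (if j = a then x j else 0) + int (count (mset js) j) * x j)"
    by (intro sum.cong) (auto simp: algebra_simps)
  also have "\<dots> = x a + (\<Sum>j<n. int (count (mset js) j) * x j)"
    using Cons.prems by (simp add: sum.distrib)
  finally show ?case using Cons by simp
qed simp

lemma finite_tensor_E: "finite (tensor_E A m n)"
  by (rule finite_subset[of _ "idx m n"]) (auto simp: tensor_E_def)

lemma incidence_mat_carrier:
  "incidence_mat A m n \<in> carrier_mat (dim_row (incidence_mat A m n)) n"
  by (simp add: incidence_mat_def Let_def)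

text \<open>Entries of a row are multiplicities, so a row applied to x is the sum of x along the
  edge.\<close>

lemma incidence_rows:
  "(\<forall>l < dim_row (incidence_mat A m n). R (mvmult (incidence_mat A m n) n x l)) \<longleftrightarrow>
    (\<forall>e \<in> tensor_E A m n. R (sum_list (map x e)))"
proof -
  define es where "es = sorted_list_of_set (tensor_E A m n)"
  have set_es: "set es = tensor_E A m n" by (simp add: es_def finite_tensor_E)
  have dim: "dim_row (incidence_mat A m n) = length es"
    by (simp add: incidence_mat_def es_def Let_def)
  have row: "mvmult (incidence_mat A m n) n x l = sum_list (map x (es ! l))" if "l < length es" for l
  proof -
    have "es ! l \<in> tensor_E A m n" using that set_es nth_mem by blast
    then have "set (es ! l) \<subseteq> {..<n}" by (auto simp: tensor_E_def idx_def)
    then show ?thesis using that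
      by (simp add: sum_list_map_eq_sum_count_lessThan[of _ n] mvmult_def incidence_mat_def es_def[symmetric] Let_def)
  qed
  show ?thesis unfolding dim set_es[symmetric] by (auto simp: row all_set_conv_all_nth)
qed

section \<open>Roots of unity and their exponents\<close>

definition unit_root :: "nat \<Rightarrow> int \<Rightarrow> complex" where
  "unit_root m k = cis (2 * pi * real_of_int k / real m)"

lemma unit_root_0 [simp]: "unit_root m 0 = 1"
  by (simp add: unit_root_def)

lemma unit_root_add: "unit_root m (a + b) = unit_root m a * unit_root m b"
  by (simp add: unit_root_def cis_mult ring_distribs add_divide_distrib)

lemma unit_root_sum_list: "unit_root m (sum_list ks) = prod_list (map (unit_root m) ks)"
  by (induction ks) (auto simp: unit_root_add)

lemma unit_root_power: "0 < m \<Longrightarrow> unit_root m k ^ m = 1"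
  by (simp add: unit_root_def DeMoivre mult.commute[of _ "2 * pi"] cis_multiple_2pi)

lemma unit_root_eq_1_iff:
  assumes "0 < m"
  shows "unit_root m k = 1 \<longleftrightarrow> int m dvd k"
proof
  assume "int m dvd k"
  then obtain j where "k = int m * j" ..
  then have "2 * pi * real_of_int k / real m = 2 * pi * real_of_int j" using assms by simp
  then show "unit_root m k = 1" by (simp only: unit_root_def cis_multiple_2pi Ints_of_int)
next
  assume "unit_root m k = 1"
  then have "cos (2 * pi * real_of_int k / real m) = 1" by (simp add: unit_root_def complex_eq_iff)
  then obtain j :: int where "2 * pi * real_of_int k / real m = real_of_int j * 2 * pi"
    using cos_one_2pi_int by blast
  then have "real_of_int k = real_of_int (j * int m)" using assms by (simp add: field_simps)
  then have "k = j * int m" by (simp only: of_int_eq_iff)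
  then show "int m dvd k" by simp
qed

lemma unit_root_obtain:
  assumes "0 < m" "z ^ m = 1"
  obtains k where "0 \<le> k" "k < int m" "z = unit_root m k"
proof -
  have "z \<in> (\<lambda>k. cis (2 * pi * real k / real m)) ` {..<m}"
    using bij_betw_roots_unity[OF assms(1)] assms(2) by (auto simp: bij_betw_def)
  then obtain k where "k < m" "z = cis (2 * pi * real k / real m)" by auto
  then show thesis by (intro that[of "int k"]) (auto simp: unit_root_def)
qed

context symmetric_weakly_irreducible_tensor
begin

text \<open>The support and R are both invariant under permutations, so the sorted representatives
  suffice. This links the stabilizer, which sees all index lists, with the incidence matrix, which
  sees sorted ones.\<close>

lemma edges_sorted_iff:
  assumes "\<And>is js. mset is = mset js \<Longrightarrow> R is \<longleftrightarrow> R js"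
  shows "(\<forall>is \<in> idx m n. A is \<noteq> 0 \<longrightarrow> R is) \<longleftrightarrow> (\<forall>e \<in> tensor_E A m n. R e)"
proof
  assume E: "\<forall>e \<in> tensor_E A m n. R e"
  show "\<forall>is \<in> idx m n. A is \<noteq> 0 \<longrightarrow> R is"
  proof (intro ballI impI)
    fix "is" assume "is": "is \<in> idx m n" "A is \<noteq> 0"
    have "A (sort is) \<noteq> 0"
      using csym[unfolded comb_symmetric_def, rule_format, OF "is"(1), of "sort is"] "is"(2) by simp
    then have "sort is \<in> tensor_E A m n" using "is" by (auto simp: tensor_E_def idx_def)
    then show "R is" using E assms[of "is" "sort is"] by simp
  qed
qed (auto simp: tensor_E_def)

lemma bij_PS0_stabilizer:
  "bij_betw (\<lambda>x i. if i < n then unit_root m (x i) else 0) (PS0 A m n) (stabilizer A m n)"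
proof -
  have m0: "0 < m" using order_ge_2 by simp
  define h where "h = (\<lambda>(x :: nat \<Rightarrow> int) i. if i < n then unit_root m (x i) else 0)"
  have h_mem: "h x \<in> stabilizer A m n \<longleftrightarrow> x \<in> PS0 A m n"
    if x: "x \<in> zsum_carrier (replicate n (int m))" and x0: "h x 0 = 1 \<longleftrightarrow> x 0 = 0" for x
  proof -
    have "prod_list (map (h x) is) = unit_root m (sum_list (map x is))" if "is \<in> idx m n" for "is"
    proof -
      have "map (h x) is = map (unit_root m) (map x is)" using that by (auto simp: h_def idx_def)
      then show ?thesis by (simp only: unit_root_sum_list)
    qed
    then have "(\<forall>is \<in> idx m n. A is \<noteq> 0 \<longrightarrow> prod_list (map (h x) is) = 1) \<longleftrightarrow>
        (\<forall>is \<in> idx m n. A is \<noteq> 0 \<longrightarrow> int m dvd sum_list (map x is))"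
      using unit_root_eq_1_iff[OF m0] by auto
    also have "\<dots> \<longleftrightarrow> (\<forall>e \<in> tensor_E A m n. int m dvd sum_list (map x e))"
      by (rule edges_sorted_iff) (metis mset_map sum_mset_sum_list)
    also have "\<dots> \<longleftrightarrow> (\<forall>l < dim_row (incidence_mat A m n). int m dvd mvmult (incidence_mat A m n) n x l)"
      by (rule incidence_rows[symmetric])
    finally show ?thesis
      using x x0 unit_root_power[OF m0] unfolding stabilizer_iff PS0_def
      by (auto simp: h_def mvmult_def mod_eq_0_iff_dvd)
  qed
  \<comment> \<open>Canonical residues matter here: within [0, m) only 0 is divisible by m.\<close>
  have h0: "h x 0 = 1 \<longleftrightarrow> x 0 = 0" if "x \<in> zsum_carrier (replicate n (int m))" for x
    using that dim_pos unit_root_eq_1_iff[OF m0, of "x 0"] zdvd_not_zless[of "x 0" "int m"]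
    by (auto simp: h_def zsum_carrier_def le_less)
  have inj: "inj_on h (PS0 A m n)"
  proof (rule inj_onI, rule ext)
    fix x y i assume x: "x \<in> PS0 A m n" and y: "y \<in> PS0 A m n" and eq: "h x = h y"
    show "x i = y i"
    proof (cases "i < n")
      case True
      have "unit_root m (x i) = unit_root m (y i)" using fun_cong[OF eq, of i] True by (simp add: h_def)
      then have "unit_root m (x i - y i) * unit_root m (y i) = unit_root m (y i)" by (simp flip: unit_root_add)
      moreover have "unit_root m (y i) \<noteq> 0" by (simp add: unit_root_def)
      ultimately have "int m dvd x i - y i" using unit_root_eq_1_iff[OF m0] by simp
      moreover have "0 \<le> x i" "x i < int m" "0 \<le> y i" "y i < int m"
        using x y True by (auto simp: PS0_def zsum_carrier_def)
      ultimately show ?thesis by (metis mod_eq_dvd_iff mod_pos_pos_trivial)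
    qed (use x y in \<open>auto simp: PS0_def zsum_carrier_def\<close>)
  qed
  have "h ` PS0 A m n = stabilizer A m n"
  proof (intro equalityI subsetI)
    fix d assume "d \<in> h ` PS0 A m n"
    then show "d \<in> stabilizer A m n" using h_mem h0 by (auto simp: PS0_def)
  next
    fix d assume d: "d \<in> stabilizer A m n"
    have "\<forall>i. \<exists>k. i < n \<longrightarrow> 0 \<le> k \<and> k < int m \<and> d i = unit_root m k"
      using stabilizer_root_of_unity[OF d] unit_root_obtain[OF m0] by metis
    then obtain k where k: "\<And>i. i < n \<Longrightarrow> 0 \<le> k i \<and> k i < int m \<and> d i = unit_root m (k i)" by metis
    define x where "x = (\<lambda>i. if i < n then k i else 0)"
    have x: "x \<in> zsum_carrier (replicate n (int m))" using k by (auto simp: x_def zsum_carrier_def)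
    have "h x = d" using k d by (auto simp: h_def x_def stabilizer_def)
    then show "d \<in> h ` PS0 A m n" using h_mem[OF x h0[OF x]] d by auto
  qed
  then show ?thesis using inj unfolding bij_betw_def h_def by blast
qed

lemma stabilizing_index_eq: "stabilizing_index A m n = card (PS0 A m n)"
  using bij_betw_same_card[OF bij_PS0_stabilizer] by (simp add: stabilizing_index_def stabilizer_def)

lemma finite_PS0: "finite (PS0 A m n)"
  by (rule finite_subset[of _ "zsum_carrier (replicate n (int m))"]) (auto simp: PS0_def)

lemma stabilizing_dimension_eq: "stabilizing_dimension A m n = cl (stabilizing_index A m n)"
proof -
  have "finite (stabilizer A m n)" "stabilizer A m n \<noteq> {}"
    using bij_betw_finite[OF bij_PS0_stabilizer] finite_PS0 stabilizer_one by auto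
  \<comment> \<open>Infinite sets have \<open>card\<close> 0, so a nonzero cardinality yields
    finiteness.\<close>
  then have "card (PV_rho A m n) \<noteq> 0" using PV_group_comm_group_card(2) by simp
  then have "finite (carrier (PV_group A m n))"
    unfolding PV_group_def by (auto intro: card_ge_0_finite)
  then have "stabilizing_dimension A m n = cl (order (PV_group A m n))"
    unfolding stabilizing_dimension_def
    using PV_group_comm_group_card(1) by (rule composition_length_eq_cl_order[rotated])
  also have "order (PV_group A m n) = card (stabilizer A m n)"
    using PV_group_comm_group_card(2) by (simp add: order_def PV_group_def)
  finally show ?thesis by (simp add: stabilizing_index_def stabilizer_def)
qed

text \<open>This rules out r = 0. Since n \<ge> 2, some arc leaves index 0 for another index j; the
  edge behind it contains 0 at least once and, because of j, at most m - 1 times.\<close>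

lemma incidence_mat_nonzero_mod:
  assumes "2 \<le> n"
  obtains l j where "l < dim_row (incidence_mat A m n)" "j < n"
    "\<not> int m dvd incidence_mat A m n $$ (l, j)"
proof -
  have "\<not> (\<forall>j. (0, j) \<in> tensor_arcs A m n \<longrightarrow> j = 0)"
  proof
    assume "\<forall>j. (0, j) \<in> tensor_arcs A m n \<longrightarrow> j = 0"
    then have "{0} = {..<n}" using dim_pos by (intro set_closed_under_arcs) auto
    then have "1 \<in> {0::nat}" using assms by simp
    then show False by simp
  qed
  then obtain j "is" where j: "j \<noteq> 0" "is \<in> idx (m - 1) n" "A (0 # is) \<noteq> 0" "j \<in> set is"
    by (auto simp: tensor_arcs_def)
  \<comment> \<open>With this indicator, the sum along an edge counts the occurrences of 0.\<close>
  define x :: "nat \<Rightarrow> int" where "x i = (if i = 0 then 1 else 0)" for i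
  have len: "length is = m - 1" using j by (simp add: idx_def)
  have x01: "0 \<le> x i" "x i \<le> 1" for i by (auto simp: x_def)
  have "sum_list (map x js) \<le> int (length js)" for js using x01(2)
    by (induction js) (auto simp: add_mono)
  then have le: "sum_list (map x (remove1 j is)) \<le> int (m - 1 - 1)"
    using j len by (metis length_remove1)
  have nonneg: "0 \<le> sum_list (map x js)" for js using x01(1) by (induction js) auto
  have "sum_list (map x is) = x j + sum_list (map x (remove1 j is))"
    using j(4) by (rule sum_list_map_remove1)
  then have "0 < sum_list (map x (0 # is))" "sum_list (map x (0 # is)) < int m"
    using le nonneg[of "is"] j(1) order_ge_2 by (auto simp: x_def)
  then have "\<not> int m dvd sum_list (map x (0 # is))" by (simp add: zdvd_not_zless)
  moreover have "0 # is \<in> idx m n" using j dim_pos order_ge_2 by (auto simp: idx_def)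
  ultimately have "\<not> (\<forall>is \<in> idx m n. A is \<noteq> 0 \<longrightarrow> int m dvd sum_list (map x is))"
    using j(3) by blast
  also have "(\<forall>is \<in> idx m n. A is \<noteq> 0 \<longrightarrow> int m dvd sum_list (map x is)) \<longleftrightarrow>
      (\<forall>e \<in> tensor_E A m n. int m dvd sum_list (map x e))"
    by (rule edges_sorted_iff) (metis mset_map sum_mset_sum_list)
  finally obtain l where l: "l < dim_row (incidence_mat A m n)"
      "\<not> int m dvd mvmult (incidence_mat A m n) n x l"
    unfolding incidence_rows[symmetric] by blast
  have "mvmult (incidence_mat A m n) n x l = (\<Sum>j<n. if j = 0 then incidence_mat A m n $$ (l, j) else 0)"
    unfolding mvmult_def x_def by (intro sum.cong) auto
  also have "\<dots> = incidence_mat A m n $$ (l, 0)" using dim_pos by simp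
  finally show thesis using that[of l 0] l dim_pos by simp
qed

end

theorem theorem3p6:
  fixes A :: "nat list \<Rightarrow> real" and m n r :: nat and d :: "nat \<Rightarrow> nat" and P Q :: "int mat"
  assumes m2: "m \<ge> 2" and n2: "n \<ge> 2"
    and nonneg: "nonneg_tensor A m n"
    and csym: "comb_symmetric A m n"
    and wirr: "weakly_irreducible A m n"
    and P: "invertible_mod (int m) (dim_row (incidence_mat A m n)) P"
    and Q: "invertible_mod (int m) n Q"
    and r_le: "r \<le> dim_row (incidence_mat A m n)" "r \<le> n"
    and d_range: "\<forall>i < r. 1 \<le> d i \<and> d i \<le> m - 1"
    and d_dvd: "\<forall>i. Suc i < r \<longrightarrow> d i dvd d (Suc i)"
    and d_dvd_m: "\<forall>i < r. d i dvd m"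
    and snf: "mod_mat (int m) (P * incidence_mat A m n * Q) =
               mat (dim_row (incidence_mat A m n)) n (\<lambda>(i, j). if i = j \<and> i < r then int (d i) else 0)"
  shows "(1 \<le> r \<and> r \<le> n - 1) \<and>
      zmod_iso (replicate n (int m)) (PS0 A m n)
           (map (\<lambda>i. int (d i)) (filter (\<lambda>i. d i \<noteq> 1) [0..<r]) @ replicate (n - 1 - r) (int m))
           (zsum_carrier (map (\<lambda>i. int (d i)) (filter (\<lambda>i. d i \<noteq> 1) [0..<r]) @ replicate (n - 1 - r) (int m))) \<and>
      stabilizing_index A m n = m ^ (n - 1 - r) * (\<Prod>i < r. d i) \<and>
      stabilizing_dimension A m n = (\<Sum>i \<in> {i. i < r \<and> d i \<noteq> 1}. cl (d i)) + (n - 1 - r) * cl m \<and>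
      stabilizing_index A m n dvd m ^ (n - 1) \<and>
      stabilizing_index A m n < m ^ (n - 1) \<and>
      stabilizing_dimension A m n < (n - 1) * cl m"
proof -
  interpret T: symmetric_weakly_irreducible_tensor A m n
    using m2 n2 nonneg csym wirr by unfold_locales auto
  define B where "B = incidence_mat A m n"
  define k where "k = dim_row B"
  obtain P' where P': "P \<in> carrier_mat k k" "P' \<in> carrier_mat k k"
      "mod_mat (int m) (P' * P) = mod_mat (int m) (1\<^sub>m k)"
    using P by (auto simp: invertible_mod_def B_def k_def)
  obtain Q' where Q': "Q \<in> carrier_mat n n" "Q' \<in> carrier_mat n n"
      "mod_mat (int m) (Q * Q') = mod_mat (int m) (1\<^sub>m n)"
      "mod_mat (int m) (Q' * Q) = mod_mat (int m) (1\<^sub>m n)"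
    using Q by (auto simp: invertible_mod_def)
  have B: "B \<in> carrier_mat k n" unfolding B_def k_def by (rule incidence_mat_carrier)
  \<comment> \<open>Every edge has m entries with multiplicity, so each row of B sums to m.\<close>
  have "\<forall>e \<in> tensor_E A m n. int m dvd sum_list (map (\<lambda>_. 1) e)"
    by (auto simp: tensor_E_def idx_def sum_list_triv)
  then have ones: "\<forall>l<k. int m dvd mvmult B n (\<lambda>_. 1) l"
    unfolding k_def B_def by (subst incidence_rows)
  interpret K: smith_kernel B P Q P' Q' m n k r d
  proof unfold_locales
    show "1 \<le> n" using n2 by simp
    show "[mvmult B n (\<lambda>_. 1) l = 0] (mod int m)" if "l < k" for l
      using ones that by (simp add: cong_0_iff)
  qed (rule m2 B P' Q' r_le[folded B_def k_def] d_range d_dvd d_dvd_m snf[folded B_def, folded k_def])+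
  have S: "PS0 A m n = K.reduced_kernel"
    unfolding PS0_def K.reduced_kernel_def by (auto simp: k_def B_def mvmult_def cong_def)
  have r1: "1 \<le> r"
  proof (rule ccontr)
    assume "\<not> 1 \<le> r"
    \<comment> \<open>With r = 0 every coordinate is free and every vector lies in the kernel; unit
      vectors then show that B vanishes modulo m.\<close>
    then have ker: "\<forall>l<k. [mvmult B n x l = 0] (mod int m)" for x
      using K.ker_iff[of x] by (simp add: K.modulus_def cong_0_iff)
    obtain l j where lj: "l < k" "j < n" "\<not> int m dvd B $$ (l, j)"
      using T.incidence_mat_nonzero_mod[OF n2] unfolding B_def k_def by blast
    have "mvmult B n (\<lambda>i. if i = j then 1 else 0) l = (\<Sum>i<n. if i = j then B $$ (l, i) else 0)"
      unfolding mvmult_def by (intro sum.cong) auto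
    also have "\<dots> = B $$ (l, j)" using lj by simp
    finally show False using ker[of "\<lambda>i. if i = j then 1 else 0"] lj by (auto simp: cong_0_iff)
  qed
  have rn: "r \<le> n - 1" using K.r_less by simp
  have index: "stabilizing_index A m n = m ^ (n - 1 - r) * (\<Prod>i<r. d i)"
    unfolding T.stabilizing_index_eq S by (rule K.card_reduced_kernel)
  have "n - 1 = n - 1 - r + r" using rn by simp
  then have pow: "m ^ (n - 1) = m ^ (n - 1 - r) * m ^ r" by (metis power_add)
  have "(\<Prod>i<r. d i) dvd (\<Prod>i<r. m)" using d_dvd_m by (intro prod_dvd_prod) auto
  then have dvd: "stabilizing_index A m n dvd m ^ (n - 1)"
    unfolding index pow by (intro mult_dvd_mono) auto
  have "(\<Prod>i<r. d i) \<le> (\<Prod>i<r. m - 1)" using d_range by (intro prod_mono) auto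
  \<comment> \<open>Strictness comes from r \<ge> 1.\<close>
  also have "\<dots> < m ^ r" using m2 r1 by (simp add: power_strict_mono)
  finally have less: "stabilizing_index A m n < m ^ (n - 1)"
    unfolding index pow using m2 by simp
  have nz: "d i \<noteq> 0" if "i < r" for i using d_range that by auto
  then have "cl (\<Prod>i<r. d i) = (\<Sum>i<r. cl (d i))" by (intro cl_prod) auto
  then have "cl (stabilizing_index A m n) = (n - 1 - r) * cl m + (\<Sum>i<r. cl (d i))"
    unfolding index using m2 nz by (simp add: cl_mult cl_power)
  also have "(\<Sum>i<r. cl (d i)) = (\<Sum>i \<in> {i. i < r \<and> d i \<noteq> 1}. cl (d i))"
    by (rule sum.mono_neutral_right) auto
  finally have dimension:
    "stabilizing_dimension A m n = (\<Sum>i \<in> {i. i < r \<and> d i \<noteq> 1}. cl (d i)) + (n - 1 - r) * cl m"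
    by (simp add: T.stabilizing_dimension_eq)
  \<comment> \<open>A proper divisor has strictly fewer prime factors, so the bound on the dimension
    follows from the two facts about the index.\<close>
  have "stabilizing_dimension A m n < cl (m ^ (n - 1))"
    unfolding T.stabilizing_dimension_eq using dvd less by (rule cl_strict_mono_dvd)
  then have "stabilizing_dimension A m n < (n - 1) * cl m" using m2 by (simp add: cl_power)
  then show ?thesis
    using r1 rn K.zmod_iso_reduced_kernel index dimension dvd less unfolding S by blast
qed

end
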